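(* Let $k\ge3$ be a fixed integer and let $h_k>0$ be the real number such that w.h.p. $\tau(\mathcal D_k,n)=(h_k+o(1))n$. Then w.h.p. $\tau(\mathcal C_k,n)=(h_k+o(1))n$.
   Context: Semi-random multigraph process (online version): fix $n$ and start with the empty multigraph on $[n]$. In each round $t$, a vertex $v_t$ is chosen uniformly at random from $[n]$, independently of all previous rounds; Builder then chooses $u_t\in[n]$ (possibly $u_t=v_t$), which may depend only on $v_1,\dots,v_t$, his earlier choices and his own randomness, and adds the edge $u_tv_t$ (loops and multiple edges allowed). For a monotone increasing property $\mathcal P$ and $0\le p\le1$, $\tau_p(\mathcal P,n)$ is the least $m$ such that some strategy yields, after $m$ rounds, a multigraph in $\mathcal P$ with probability at least $p$. "W.h.p. $\tau(\mathcal P,n)=(c+o(1))n$" means that for every fixed $\delta>0$, $\tau_{1-o(1)}(\mathcal P,n)\le(c+\delta)n$ and $\tau_{o(1)}(\mathcal P,n)\ge(c-\delta)n$ (i.e., for every strategy, w.h.p. $\mathcal P$ fails after $(c-\delta)n$ rounds). $\mathcal D_k$ is the property that every vertex has at least $k$ distinct neighbours other than itself; $\mathcal C_k$ is the property of being $k$-vertex-connected. (The existence of $h_k$ is a separate result of the paper.) *)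

theory Defs
  imports "HOL-Probability.Probability" "HOL-Library.Multiset" "HOL-Library.Uprod"
begin

text \<open>A multigraph is a vertex set together with a multiset of unordered pairs; the pair
  \<open>Upair x x\<close> is a loop.\<close>

type_synonym 'a multigraph_property = "'a set \<Rightarrow> 'a uprod multiset \<Rightarrow> bool"

definition neighbours :: "'a set \<Rightarrow> 'a uprod multiset \<Rightarrow> 'a \<Rightarrow> 'a set" where
  "neighbours V E x = {y \<in> V. y \<noteq> x \<and> Upair x y \<in># E}"

definition min_neighbours :: "nat \<Rightarrow> 'a multigraph_property" where
  "min_neighbours k V E \<longleftrightarrow> (\<forall>x\<in>V. k \<le> card (neighbours V E x))"

text \<open>Edges with an endpoint outside \<open>V\<close> are ignored, so \<open>connected_on (V - S) E\<close> says
  that deleting the vertices in \<open>S\<close> leaves a connected multigraph.\<close>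

definition connected_on :: "'a multigraph_property" where
  "connected_on V E \<longleftrightarrow> V \<noteq> {} \<and>
     (\<forall>x\<in>V. \<forall>y\<in>V. (x, y) \<in> {(a, b). a \<in> V \<and> b \<in> V \<and> Upair a b \<in># E}\<^sup>*)"

definition vertex_connected :: "nat \<Rightarrow> 'a multigraph_property" where
  "vertex_connected k V E \<longleftrightarrow> k < card V \<and>
     (\<forall>S. S \<subseteq> V \<and> card S < k \<longrightarrow> connected_on (V - S) E)"

text \<open>Histories list the pairs \<open>(u\<^sub>i, v\<^sub>i)\<close> in chronological order. A (randomised) strategy of
  Builder maps the history of the previous rounds and the current random vertex \<open>v\<^sub>t\<close> to the
  conditional distribution of his choice \<open>u\<^sub>t\<close>.\<close>

type_synonym strategy = "(nat \<times> nat) list \<Rightarrow> nat \<Rightarrow> nat pmf"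

definition builder_strategy :: "nat \<Rightarrow> strategy \<Rightarrow> bool" where
  "builder_strategy n \<sigma> \<longleftrightarrow> (\<forall>hist v. set_pmf (\<sigma> hist v) \<subseteq> {1..n})"

text \<open>Only meaningful for \<open>n \<ge> 1\<close>, as \<open>pmf_of_set {}\<close> is unspecified.\<close>

primrec semi_random :: "nat \<Rightarrow> strategy \<Rightarrow> nat \<Rightarrow> (nat \<times> nat) list pmf" where
  "semi_random n \<sigma> 0 = return_pmf []"
| "semi_random n \<sigma> (Suc t) =
     bind_pmf (semi_random n \<sigma> t) (\<lambda>hist.
     bind_pmf (pmf_of_set {1..n}) (\<lambda>v.
     bind_pmf (\<sigma> hist v) (\<lambda>u. return_pmf (hist @ [(u, v)]))))"

definition edges_of :: "(nat \<times> nat) list \<Rightarrow> nat uprod multiset" where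
  "edges_of hist = mset (map (\<lambda>(u, v). Upair u v) hist)"

text \<open>The value is \<open>\<infinity>\<close> if no number of rounds suffices (for instance if \<open>p > 0\<close> and \<open>n\<close> is too
  small for the property to hold at all); otherwise the infimum is a minimum.\<close>

definition tau :: "real \<Rightarrow> nat multigraph_property \<Rightarrow> nat \<Rightarrow> enat" where
  "tau p P n = Inf {enat m | m. \<exists>\<sigma>. builder_strategy n \<sigma> \<and>
     measure_pmf.prob (semi_random n \<sigma> m) {hist. P {1..n} (edges_of hist)} \<ge> p}"

text \<open>W.h.p. \<open>\<tau>(P, n) = (c + o(1)) n\<close>. The subscripts \<open>1 - o(1)\<close> and \<open>o(1)\<close> stand for some
  sequence of probabilities tending to 1 and to 0, respectively. A universal reading of the
  latter would be void, since \<open>\<tau>\<^sub>0(P, n) = 0\<close> for \<open>n \<ge> 1\<close>.\<close>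

definition whp_tau_asymp :: "nat multigraph_property \<Rightarrow> real \<Rightarrow> bool" where
  "whp_tau_asymp P c \<longleftrightarrow> (\<forall>\<delta>>0.
     (\<exists>p. (\<forall>n. 0 \<le> p n \<and> p n \<le> 1) \<and> p \<longlonglongrightarrow> 1 \<and>
        (\<forall>\<^sub>F n in sequentially.
           ereal_of_enat (tau (p n) P n) \<le> ereal ((c + \<delta>) * real n))) \<and>
     (\<exists>p. (\<forall>n. 0 \<le> p n \<and> p n \<le> 1) \<and> p \<longlonglongrightarrow> 0 \<and>
        (\<forall>\<^sub>F n in sequentially.
           ereal ((c - \<delta>) * real n) \<le> ereal_of_enat (tau (p n) P n))))"

end

theory Submission
  imports Defs "HOL-Real_Asymp.Real_Asymp"
begin

text \<open>
  The lower bound holds because \<open>k\<close>-connectivity implies minimum degree \<open>k\<close>. For the upper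
  bound, take a strategy for minimum degree \<open>k\<close>, made deterministic, and play it with a delay
  of one round: the vertex it would join to \<open>v\<^sub>t\<^sub>-\<^sub>1\<close> is joined to \<open>v\<^sub>t\<close> instead. Every vertex
  keeps its demand for edges, but now \<open>v\<^sub>t\<close> is uniform and independent of the chosen vertex
  \<open>u\<^sub>t\<close>. If \<open>u\<^sub>t\<close> already has \<open>k\<close> neighbours, it is replaced by a vertex that has fewer. Each
  round then produces a loop or a parallel edge with probability at most \<open>k / n\<close>, so the
  expected number of wasted rounds is bounded, and a few extra rounds repair them.

  As each vertex is chosen only while its degree is below \<open>k\<close>, a set \<open>W\<close> of \<open>m\<close> vertices has at
  most \<open>k m\<close> chances to gain an inner edge, each with probability about \<open>m / n\<close>. A union bound
  shows that w.h.p. no set of at most \<open>\<surd>n\<close> vertices spans noticeably more edges than vertices.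
  A small set with minimum degree \<open>k \<ge> 3\<close> and fewer than \<open>k\<close> outer neighbours would, with these
  neighbours, form such a dense set; so after deleting fewer than \<open>k\<close> vertices all components
  have about \<open>\<surd>n\<close> vertices or more. Finally \<open>k\<close> hubs are each joined to linearly many random
  vertices: w.h.p. every hub reaches every such component, and one hub survives the deletion.
\<close>

section \<open>Deterministic strategies as averages over vertex sequences\<close>

text \<open>The expectation of \<open>f (v\<^sub>1, \<dots>, v\<^sub>N)\<close> for independent uniform \<open>v\<^sub>i\<close>.\<close>

primrec seq_avg :: "nat \<Rightarrow> nat \<Rightarrow> (nat list \<Rightarrow> real) \<Rightarrow> real" where
  "seq_avg n 0 f = f []"
| "seq_avg n (Suc N) f = seq_avg n N (\<lambda>xs. (\<Sum>v\<in>{1..n}. f (xs @ [v])) / real n)"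

lemma seq_avg_mono:
  assumes "\<And>xs. length xs = N \<Longrightarrow> set xs \<subseteq> {1..n} \<Longrightarrow> f xs \<le> g xs"
  shows "seq_avg n N f \<le> seq_avg n N g"
  using assms
proof (induction N arbitrary: f g)
  case (Suc N)
  show ?case unfolding seq_avg.simps
    by (rule Suc.IH) (auto intro!: divide_right_mono sum_mono Suc.prems)
qed auto

lemma seq_avg_cong:
  assumes "\<And>xs. length xs = N \<Longrightarrow> set xs \<subseteq> {1..n} \<Longrightarrow> f xs = g xs"
  shows "seq_avg n N f = seq_avg n N g"
  by (rule antisym; rule seq_avg_mono) (use assms in auto)

lemma seq_avg_const: "n > 0 \<Longrightarrow> seq_avg n N (\<lambda>_. c) = c"
  by (induction N) auto

lemma seq_avg_add: "seq_avg n N (\<lambda>xs. f xs + g xs) = seq_avg n N f + seq_avg n N g"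
  by (induction N arbitrary: f g) (auto simp: sum.distrib add_divide_distrib)

lemma seq_avg_cmult: "seq_avg n N (\<lambda>xs. c * f xs) = c * seq_avg n N f"
  by (induction N arbitrary: f)
     (auto simp: sum_distrib_left[symmetric] times_divide_eq_right[symmetric]
           simp del: times_divide_eq_right)

lemma seq_avg_sum: "seq_avg n N (\<lambda>xs. \<Sum>i\<in>I. f i xs) = (\<Sum>i\<in>I. seq_avg n N (f i))"
proof (cases "finite I")
  case True
  then show ?thesis
  proof (induction I)
    case empty
    \<comment> \<open>\<open>seq_avg_const\<close> needs \<open>n > 0\<close>; factoring out 0
      covers \<open>n = 0\<close> as well.\<close>
    show ?case using seq_avg_cmult[of n N 0 "\<lambda>_. 0"] by simp
  qed (simp add: seq_avg_add)
next
  case False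
  then show ?thesis using seq_avg_cmult[of n N 0 "\<lambda>_. 0"] by simp
qed

text \<open>Vertices drawn after round \<open>N\<close> average out, so an event about a prefix can
  be evaluated within a longer run.\<close>

lemma seq_avg_take:
  assumes "n > 0"
  shows "seq_avg n (N + j) (\<lambda>xs. f (take N xs)) = seq_avg n N f"
proof (induction j)
  case 0
  show ?case by (auto intro: seq_avg_cong)
next
  case (Suc j)
  have "seq_avg n (N + Suc j) (\<lambda>xs. f (take N xs)) = seq_avg n (N + j) (\<lambda>xs. f (take N xs))"
    using assms by (auto intro!: seq_avg_cong)
  with Suc show ?case by simp
qed

lemma seq_avg_supermartingale:
  assumes "\<And>xs. length xs < N \<Longrightarrow> set xs \<subseteq> {1..n} \<Longrightarrow>
             (\<Sum>v\<in>{1..n}. f (xs @ [v])) / real n \<le> f xs"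
  shows "seq_avg n N f \<le> f []"
  using assms
proof (induction N)
  case (Suc N)
  have "seq_avg n (Suc N) f \<le> seq_avg n N f"
    unfolding seq_avg.simps by (rule seq_avg_mono) (use Suc.prems in auto)
  also have "\<dots> \<le> f []" using Suc by auto
  finally show ?case .
qed auto

section \<open>Deterministic strategies and their winning probabilities\<close>

definition det_step :: "((nat \<times> nat) list \<Rightarrow> nat \<Rightarrow> nat) \<Rightarrow> (nat \<times> nat) list \<Rightarrow> nat \<Rightarrow> (nat \<times> nat) list"
  where "det_step d hist v = hist @ [(d hist v, v)]"

definition det_history :: "((nat \<times> nat) list \<Rightarrow> nat \<Rightarrow> nat) \<Rightarrow> nat list \<Rightarrow> (nat \<times> nat) list"
  where "det_history d = foldl (det_step d) []"

lemma det_history_Nil [simp]: "det_history d [] = []"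
  by (simp add: det_history_def)

lemma det_history_snoc [simp]:
  "det_history d (vs @ [v]) = det_history d vs @ [(d (det_history d vs) v, v)]"
  by (simp add: det_history_def det_step_def)

lemma map_snd_det_history [simp]: "map snd (det_history d vs) = vs"
  by (induction vs rule: rev_induct) auto

lemma length_det_history [simp]: "length (det_history d vs) = length vs"
  by (metis length_map map_snd_det_history)

lemma finite_set_pmf_strategy: "builder_strategy n \<sigma> \<Longrightarrow> finite (set_pmf (\<sigma> hist v))"
  by (meson builder_strategy_def finite_atLeastAtMost finite_subset)

lemma finite_set_pmf_semi_random:
  assumes "n > 0" "builder_strategy n \<sigma>"
  shows "finite (set_pmf (semi_random n \<sigma> t))"
  using assms by (induction t) (auto simp: finite_set_pmf_strategy)

lemma expectation_semi_random_Suc: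
  fixes f :: "(nat \<times> nat) list \<Rightarrow> real"
  assumes "n > 0" "builder_strategy n \<sigma>"
  shows "measure_pmf.expectation (semi_random n \<sigma> (Suc t)) f =
    measure_pmf.expectation (semi_random n \<sigma> t) (\<lambda>hist. (\<Sum>v\<in>{1..n}.
      measure_pmf.expectation (\<sigma> hist v) (\<lambda>u. f (hist @ [(u, v)]))) / real n)"
proof -
  note fin = finite_set_pmf_semi_random[OF assms] finite_set_pmf_strategy[OF assms(2)]
  have "measure_pmf.expectation (bind_pmf (pmf_of_set {1..n}) (\<lambda>v.
     bind_pmf (\<sigma> hist v) (\<lambda>u. return_pmf (hist @ [(u, v)])))) f =
     (\<Sum>v\<in>{1..n}. measure_pmf.expectation (\<sigma> hist v) (\<lambda>u. f (hist @ [(u, v)]))) / real n"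
    for hist
  proof -
    have "measure_pmf.expectation (bind_pmf (\<sigma> hist v) (\<lambda>u. return_pmf (hist @ [(u, v)]))) f =
      measure_pmf.expectation (\<sigma> hist v) (\<lambda>u. f (hist @ [(u, v)]))" for v
      by (simp flip: map_pmf_def)
    then show ?thesis
      using assms(1)
      by (subst pmf_expectation_bind_pmf_of_set)
         (auto simp: fin divide_inverse_commute sum_distrib_left)
  qed
  then show ?thesis
    unfolding semi_random.simps using assms(1)
    by (subst pmf_expectation_bind[OF fin(1)])
       (auto simp: fin integral_measure_pmf[OF fin(1)[of t]] simp del: integral_divide_zero)
qed

text \<open>Translates winning probabilities into finite averages over the drawn vertices, in which
  the new strategy is analysed.\<close>

lemma prob_det_strategy:
  assumes "n > 0" "\<And>hist v. d hist v \<in> {1..n}"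
  shows "measure_pmf.prob (semi_random n (\<lambda>hist v. return_pmf (d hist v)) t) {hist. Q hist} =
           seq_avg n t (\<lambda>vs. of_bool (Q (det_history d vs)))"
proof -
  have *: "builder_strategy n (\<lambda>hist v. return_pmf (d hist v))"
    using assms(2) by (auto simp: builder_strategy_def)
  have "measure_pmf.expectation (semi_random n (\<lambda>hist v. return_pmf (d hist v)) t) f =
      seq_avg n t (\<lambda>vs. f (det_history d vs))" for f :: "_ \<Rightarrow> real"
    by (induction t arbitrary: f)
       (simp_all add: expectation_semi_random_Suc[OF assms(1) *] del: semi_random.simps(2) integral_divide_zero)
  from this[of "indicator {hist. Q hist}"] show ?thesis
    by (simp add: indicator_def of_bool_def)
qed

text \<open>The optimal winning probability with \<open>r\<close> rounds left; randomisation cannot exceed it, and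
  maximising it in every round attains it.\<close>

primrec opt_val :: "nat \<Rightarrow> ((nat \<times> nat) list \<Rightarrow> bool) \<Rightarrow> nat \<Rightarrow> (nat \<times> nat) list \<Rightarrow> real" where
  "opt_val n Q 0 hist = of_bool (Q hist)"
| "opt_val n Q (Suc r) hist =
     (\<Sum>v\<in>{1..n}. Max ((\<lambda>u. opt_val n Q r (hist @ [(u, v)])) ` {1..n})) / real n"

text \<open>Each round is shifted from \<open>t\<close> to \<open>r\<close>: Builder's random choice
  averages values that are at most the maximum in \<open>opt_val\<close>.\<close>

lemma expectation_opt_val_le:
  assumes "n > 0" "builder_strategy n \<sigma>"
  shows "measure_pmf.expectation (semi_random n \<sigma> t) (opt_val n Q r) \<le> opt_val n Q (t + r) []"
proof (induction t arbitrary: r)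
  case (Suc t)
  have "measure_pmf.expectation (semi_random n \<sigma> (Suc t)) (opt_val n Q r) = 
     measure_pmf.expectation (semi_random n \<sigma> t) (\<lambda>hist. (\<Sum>v\<in>{1..n}.
      measure_pmf.expectation (\<sigma> hist v) (\<lambda>u. opt_val n Q r (hist @ [(u, v)]))) / real n)"
    by (rule expectation_semi_random_Suc[OF assms])
  also have "\<dots> \<le> measure_pmf.expectation (semi_random n \<sigma> t) (opt_val n Q (Suc r))"
  proof (rule integral_mono)
    fix hist
    show "(\<Sum>v\<in>{1..n}. measure_pmf.expectation (\<sigma> hist v) (\<lambda>u. opt_val n Q r (hist @ [(u, v)])))
       / real n \<le> opt_val n Q (Suc r) hist"
      unfolding opt_val.simps
    proof (intro divide_right_mono sum_mono)
      fix v
      show "measure_pmf.expectation (\<sigma> hist v) (\<lambda>u. opt_val n Q r (hist @ [(u, v)]))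
         \<le> Max ((\<lambda>u. opt_val n Q r (hist @ [(u, v)])) ` {1..n})" (is "_ \<le> ?M")
      proof -
        have "measure_pmf.expectation (\<sigma> hist v) (\<lambda>u. opt_val n Q r (hist @ [(u, v)])) \<le>
          measure_pmf.expectation (\<sigma> hist v) (\<lambda>u. ?M)"
        proof (rule integral_mono_AE)
          show "AE u in measure_pmf (\<sigma> hist v). opt_val n Q r (hist @ [(u, v)]) \<le> ?M"
            using assms(2) by (auto simp: AE_measure_pmf_iff builder_strategy_def intro!: Max_ge)
        qed (auto intro: integrable_measure_pmf_finite finite_set_pmf_strategy assms)
        then show ?thesis by simp
      qed
    qed auto
  qed (auto intro: integrable_measure_pmf_finite finite_set_pmf_semi_random assms)
  also have "\<dots> \<le> opt_val n Q (Suc t + r) []" using Suc[of "Suc r"] by (simp only: add_Suc_shift)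
  finally show ?case .
qed simp

text \<open>The replies of a deterministic Builder are functions of the drawn vertices alone, so the
  delayed strategy can simulate them.\<close>

lemma derandomise:
  assumes "n > 0" "builder_strategy n \<sigma>"
  obtains d where "\<And>hist v. d hist v \<in> {1..n}"
    "measure_pmf.prob (semi_random n \<sigma> M) {hist. Q hist} \<le>
       seq_avg n M (\<lambda>vs. of_bool (Q (det_history d vs)))"
proof -
  have "\<exists>u. u \<in> {1..n} \<and> g u = Max (g ` {1..n})" for g :: "nat \<Rightarrow> real"
    using Max_in[of "g ` {1..n}"] assms(1) by (auto simp del: Max_in)
  then obtain best :: "(nat \<Rightarrow> real) \<Rightarrow> nat"
    where best: "\<And>g. best g \<in> {1..n} \<and> g (best g) = Max (g ` {1..n})" by metis
  \<comment> \<open>Strategies receive no round number; the rounds left after the present one are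
    read off from the length of the history.\<close>
  define d where "d hist v = best (\<lambda>u. opt_val n Q (M - Suc (length hist)) (hist @ [(u, v)]))"
    for hist v
  have d_max: "opt_val n Q (M - Suc (length hist)) (hist @ [(d hist v, v)]) =
    Max ((\<lambda>u. opt_val n Q (M - Suc (length hist)) (hist @ [(u, v)])) ` {1..n})" for hist v
    unfolding d_def by (rule best[THEN conjunct2])
  have "seq_avg n t (\<lambda>vs. opt_val n Q (M - t) (det_history d vs)) = opt_val n Q M []"
    if "t \<le> M" for t
    using that
  proof (induction t)
    case (Suc t)
    then have eq: "M - t = Suc (M - Suc t)" by auto
    have "seq_avg n (Suc t) (\<lambda>vs. opt_val n Q (M - Suc t) (det_history d vs)) =
      seq_avg n t (\<lambda>vs. opt_val n Q (M - t) (det_history d vs))"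
      unfolding eq using d_max[of "det_history d _", unfolded length_det_history]
      by (auto intro!: seq_avg_cong sum.cong)
    with Suc show ?case by simp
  qed simp
  from this[of M] have "seq_avg n M (\<lambda>vs. of_bool (Q (det_history d vs))) = opt_val n Q M []"
    by simp
  moreover have "measure_pmf.prob (semi_random n \<sigma> M) {hist. Q hist} =
     measure_pmf.expectation (semi_random n \<sigma> M) (opt_val n Q 0)"
  proof -
    have "opt_val n Q 0 = indicator {hist. Q hist}" by (auto simp: indicator_def)
    then show ?thesis by (simp del: opt_val.simps)
  qed
  ultimately show ?thesis
    using that[of d] best expectation_opt_val_le[OF assms, of M Q 0] by (simp add: d_def)
qed

section \<open>The process of joining low-degree vertices to random vertices\<close>

text \<open>Graphs are symmetric relations, so an edge inside \<open>W\<close> counts twice in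
  \<open>card (E \<inter> W \<times> W)\<close>. Rounds with a chosen vertex of degree at least \<open>k\<close> are ignored.\<close>

definition low_step :: "nat \<Rightarrow> nat \<Rightarrow> nat \<Rightarrow> nat rel \<Rightarrow> nat rel" where
  "low_step k u v E = (if card (E `` {u}) < k \<and> v \<noteq> u then E \<union> {(u, v), (v, u)} else E)"

definition sgraph :: "'a set \<Rightarrow> 'a rel \<Rightarrow> bool" where
  "sgraph V E \<longleftrightarrow> E \<subseteq> V \<times> V \<and> sym E \<and> irrefl E"

text \<open>A wasted round. Rounds with a saturated \<open>u\<close> are excluded: under
  \<open>pick\<close> they occur only once every vertex has degree at least
  \<open>k\<close>.\<close>

definition bad_round :: "nat \<Rightarrow> nat \<Rightarrow> nat \<Rightarrow> nat rel \<Rightarrow> bool" where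
  "bad_round k u v E \<longleftrightarrow> card (E `` {u}) < k \<and> (v = u \<or> (u, v) \<in> E)"

lemma sgraph_low_step: "sgraph V E \<Longrightarrow> u \<in> V \<Longrightarrow> v \<in> V \<Longrightarrow> sgraph V (low_step k u v E)"
  by (auto simp: sgraph_def low_step_def sym_def irrefl_def)

lemma finite_sgraph: "finite V \<Longrightarrow> sgraph V E \<Longrightarrow> finite E"
  by (auto simp: sgraph_def intro: finite_subset)

lemma low_step_same:
  "sgraph V E \<Longrightarrow> (u, v) \<in> E \<or> v = u \<or> k \<le> card (E `` {u}) \<Longrightarrow> low_step k u v E = E"
  by (auto simp: sgraph_def low_step_def sym_def)

lemma low_step_mono: "E \<subseteq> low_step k u v E"
  by (auto simp: low_step_def)

lemma low_step_degree:
  assumes "finite V" "sgraph V E" "card (E `` {u}) < k" "\<not> bad_round k u v E"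
  shows "card (low_step k u v E `` {x}) = card (E `` {x}) + of_bool (x = u) + of_bool (x = v)"
proof -
  have nb: "v \<noteq> u" "(u, v) \<notin> E" "(v, u) \<notin> E"
    using assms by (auto simp: bad_round_def sgraph_def sym_def)
  have fin: "finite (E `` {x})" using finite_sgraph[OF assms(1,2)] by (rule finite_Image)
  have "low_step k u v E `` {x} =
     (if x = u then insert v (E `` {x}) else if x = v then insert u (E `` {x}) else E `` {x})"
    using nb assms(3) by (auto simp: low_step_def)
  then show ?thesis using nb fin by auto
qed

lemma degree_mono:
  assumes "finite V" "sgraph V E'" "E \<subseteq> E'"
  shows "card (E `` {x}) \<le> card (E' `` {x})"
  using assms finite_sgraph[OF assms(1,2)] by (intro card_mono) auto

lemma low_step_inside:
  assumes "finite V" "sgraph V E" "card (E `` {u}) < k" "\<not> bad_round k u v E" "u \<in> W"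
  shows "card (low_step k u v E \<inter> W \<times> W) div 2 = card (E \<inter> W \<times> W) div 2 + of_bool (v \<in> W)"
proof -
  have nb: "v \<noteq> u" "(u, v) \<notin> E" "(v, u) \<notin> E"
    using assms by (auto simp: bad_round_def sgraph_def sym_def)
  have fin: "finite E" using finite_sgraph[OF assms(1,2)] .
  have "low_step k u v E \<inter> W \<times> W =
     (if v \<in> W then insert (u, v) (insert (v, u) (E \<inter> W \<times> W)) else E \<inter> W \<times> W)"
    using nb assms(3,5) by (auto simp: low_step_def)
  then show ?thesis using nb fin by auto
qed

lemma low_step_outside:
  assumes "u \<notin> W"
  shows "low_step k u v E \<inter> W \<times> W = E \<inter> W \<times> W"
  using assms by (auto simp: low_step_def)

text \<open>Only \<open>u\<close> itself and its at most \<open>k - 1\<close> neighbours are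
  bad.\<close>

lemma card_bad_round_le:
  assumes "finite V" "sgraph V E"
  shows "card {v\<in>V. bad_round k u v E} \<le> k"
proof (cases "card (E `` {u}) < k")
  case True
  have "{v\<in>V. bad_round k u v E} \<subseteq> insert u (E `` {u})"
    by (auto simp: bad_round_def)
  then have "card {v\<in>V. bad_round k u v E} \<le> card (insert u (E `` {u}))"
    using finite_sgraph[OF assms] by (intro card_mono) auto
  also have "\<dots> \<le> Suc (card (E `` {u}))"
    using finite_Image[OF finite_sgraph[OF assms]] by (simp add: card_insert_if)
  finally show ?thesis using True by simp
next
  case False
  then have "{v\<in>V. bad_round k u v E} = {}" by (auto simp: bad_round_def)
  then show ?thesis by (metis card.empty zero_le)
qed

text \<open>With \<open>R\<close> chances left and \<open>j\<close> inner edges missing, the probability that \<open>W\<close> still reaches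
  \<open>a\<close> inner edges is at most \<open>(R choose j) p\<^sup>j\<close>; this bound is a supermartingale. A bad round uses
  up no chance, which costs the denominator \<open>n - k\<close> instead of \<open>n\<close> in \<open>p\<close>.\<close>

definition edge_potential :: "nat \<Rightarrow> nat set \<Rightarrow> nat \<Rightarrow> real \<Rightarrow> nat rel \<Rightarrow> real" where
  "edge_potential k W a p E =
     real ((\<Sum>w\<in>W. k - card (E `` {w})) choose (a - card (E \<inter> W \<times> W) div 2)) *
     p ^ (a - card (E \<inter> W \<times> W) div 2)"

text \<open>Pascal's rule for \<open>Suc R choose Suc j\<close>: a drawn vertex that is not bad uses
  up a chance, leaving \<open>R choose j\<close> if it lies in \<open>W\<close> (one missing edge
  fewer) and \<open>R choose Suc j\<close> otherwise; a bad one changes nothing.\<close>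

lemma edge_potential_step:
  assumes V: "finite V" "k < card V" and E: "sgraph V E" and "u \<in> V" "W \<subseteq> V"
    and p: "p = real (card W) / real (card V - k)"
  shows "(\<Sum>v\<in>V. edge_potential k W a p (low_step k u v E)) \<le>
           real (card V) * edge_potential k W a p E"
proof -
  let ?R = "\<lambda>E. \<Sum>w\<in>W. k - card (E `` {w})"
  let ?I = "\<lambda>E. card (E \<inter> W \<times> W) div 2"
  let ?\<Psi> = "edge_potential k W a p"
  have p0: "p \<ge> 0" using p by simp
  have finW: "finite W" using assms finite_subset by blast
  have step: "sgraph V (low_step k u v E)" if "v \<in> V" for v
    using sgraph_low_step[OF E \<open>u \<in> V\<close> that] .
  have R_le: "?R (low_step k u v E) \<le> ?R E" if "v \<in> V" for v
    by (intro sum_mono diff_le_mono2 degree_mono[OF V(1) step[OF that] low_step_mono])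
  show ?thesis
  proof (cases "u \<in> W \<and> card (E `` {u}) < k \<and> ?I E < a")
    \<comment> \<open>Here no draw increases the potential: either it already equals 1 because
      \<open>a\<close> inner edges are present, or this round cannot add an inner edge.\<close>
    case False
    have "?\<Psi> (low_step k u v E) \<le> ?\<Psi> E" if v: "v \<in> V" for v
    proof (cases "a \<le> ?I E")
      case True
      moreover have "?I E \<le> ?I (low_step k u v E)"
        using finite_sgraph[OF V(1) step[OF v]] low_step_mono[of E k u v]
        by (intro div_le_mono card_mono) auto
      ultimately show ?thesis by (simp add: edge_potential_def)
    next
      case nle: False
      have "?I (low_step k u v E) = ?I E"
      proof (cases "u \<in> W")
        case True
        with False nle have "k \<le> card (E `` {u})" by auto
        then show ?thesis using low_step_same[OF E] by simp
      qed (simp add: low_step_outside)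
      then show ?thesis unfolding edge_potential_def
        using p0 R_le[OF v] by (auto intro!: mult_right_mono binomial_right_mono)
    qed
    then show ?thesis by (rule sum_bounded_above)
  next
    case True
    then have u: "u \<in> W" "card (E `` {u}) < k" by auto
    obtain j where j: "a - ?I E = Suc j" using True by (metis Suc_diff_Suc)
    have "?R E > 0" using u finW
      by (metis (no_types, lifting) sum_eq_0_iff zero_less_diff not_gr_zero)
    then obtain R where R: "?R E = Suc R" by (metis gr0_implies_Suc)
    let ?X = "real ((R choose j) + (R choose Suc j)) * p ^ Suc j"
    let ?Y = "real (R choose j) * p ^ j" and ?Z = "real (R choose Suc j) * p ^ Suc j"
    let ?B = "{v\<in>V. bad_round k u v E}"
    let ?G = "{v\<in>V. \<not> bad_round k u v E \<and> v \<in> W}"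
    let ?O = "{v\<in>V. \<not> bad_round k u v E \<and> v \<notin> W}"
    have X: "?\<Psi> E = ?X" by (simp add: edge_potential_def j R)
    have bad: "?\<Psi> (low_step k u v E) \<le> ?X" if "v \<in> ?B" for v
      using that low_step_same[OF E, of u v k] X by (auto simp: bad_round_def)
    have R': "?R (low_step k u v E) \<le> R" if v: "v \<in> V" "\<not> bad_round k u v E" for v
    proof -
      have "?R (low_step k u v E) < ?R E"
      proof (rule sum_strict_mono_ex1[OF finW])
        show "\<forall>x\<in>W. k - card (low_step k u v E `` {x}) \<le> k - card (E `` {x})"
          using degree_mono[OF V(1) step[OF v(1)] low_step_mono] by (intro ballI diff_le_mono2)
        show "\<exists>x\<in>W. k - card (low_step k u v E `` {x}) < k - card (E `` {x})"
          using u low_step_degree[OF V(1) E u(2) v(2), of u] by (intro bexI[of _ u]) auto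
      qed
      then show ?thesis using R by simp
    qed
    have good: "?\<Psi> (low_step k u v E) \<le> ?Y" if "v \<in> ?G" for v
    proof -
      have "a - ?I (low_step k u v E) = j"
        using that low_step_inside[OF V(1) E u(2) _ u(1), of v] j by auto
      then show ?thesis unfolding edge_potential_def
        using p0 R'[of v] that by (auto intro!: mult_right_mono binomial_right_mono)
    qed
    have out: "?\<Psi> (low_step k u v E) \<le> ?Z" if "v \<in> ?O" for v
    proof -
      have "a - ?I (low_step k u v E) = Suc j"
        using that low_step_inside[OF V(1) E u(2) _ u(1), of v] j by auto
      then show ?thesis unfolding edge_potential_def
        using p0 R'[of v] that by (auto intro!: mult_right_mono binomial_right_mono simp del: power_Suc)
    qed
    have split: "?B \<union> (?G \<union> ?O) = V" by auto
    have fin: "finite ?B" "finite ?G" "finite ?O" using V(1) by auto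
    have disj: "?B \<inter> (?G \<union> ?O) = {}" "?G \<inter> ?O = {}" by auto
    have cards: "card V = card ?B + (card ?G + card ?O)"
      using card_Un_disjoint[OF fin(1) finite_UnI[OF fin(2,3)] disj(1)]
        card_Un_disjoint[OF fin(2,3) disj(2)] unfolding split by linarith
    have "(\<Sum>v\<in>?B \<union> (?G \<union> ?O). ?\<Psi> (low_step k u v E)) =
      (\<Sum>v\<in>?B. ?\<Psi> (low_step k u v E)) + ((\<Sum>v\<in>?G. ?\<Psi> (low_step k u v E))
        + (\<Sum>v\<in>?O. ?\<Psi> (low_step k u v E)))"
      by (simp only: sum.union_disjoint[OF fin(1) finite_UnI[OF fin(2,3)] disj(1)]
        sum.union_disjoint[OF fin(2,3) disj(2)])
    also have "\<dots> \<le> real (card ?B) * ?X + (real (card ?G) * ?Y + real (card ?O) * ?Z)"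
      using bad good out by (intro add_mono sum_bounded_above) blast+
    also have "\<dots> \<le> real (card V) * ?X"
    proof -
      \<comment> \<open>Since \<open>?X = p * ?Y + ?Z\<close>, it suffices that
        \<open>card ?G\<close> is at most \<open>p\<close> times the number of vertices that are not
        bad. There are at least \<open>card V - k\<close> of these, hence the denominator of
        \<open>p\<close>.\<close>
      have "card ?G \<le> card W" by (intro card_mono finW) auto
      moreover have "real (card V - k) * p = card W" using V(2) p by simp
      moreover have "real (card V - k) * p \<le> real (card ?G + card ?O) * p"
        using cards card_bad_round_le[OF V(1) E, of k u] p0 by (intro mult_right_mono) auto
      ultimately have "real (card ?G) \<le> real (card ?G + card ?O) * p" by linarith
      then have "?Y * real (card ?G) \<le> ?Y * (real (card ?G + card ?O) * p)"
        using p0 by (intro mult_left_mono) auto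
      moreover have "0 \<le> real (card ?G) * ?Z" using p0 by simp
      ultimately show ?thesis unfolding cards by (simp add: algebra_simps)
    qed
    finally show ?thesis unfolding split X .
  qed
qed

text \<open>The move \<open>u vs\<close> is a function of the earlier vertices only, which encodes
  that the vertex drawn next is uniform and independent of it.\<close>

locale low_process =
  fixes n k :: nat and u :: "nat list \<Rightarrow> nat" and G :: "nat list \<Rightarrow> nat rel"
  assumes k_less: "k < n"
    and move_in: "u vs \<in> {1..n}"
    and G_Nil [simp]: "G [] = {}"
    and G_snoc [simp]: "G (vs @ [v]) = low_step k (u vs) v (G vs)"
begin

lemma sgraph_G: "set vs \<subseteq> {1..n} \<Longrightarrow> sgraph {1..n} (G vs)"
proof (induction vs rule: rev_induct)
  case Nil
  show ?case by (simp add: sgraph_def sym_def irrefl_def)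
next
  case (snoc v vs)
  then show ?case using sgraph_low_step[OF _ move_in] by simp
qed

text \<open>The potential is nonnegative and equals 1 once \<open>W\<close> has \<open>a\<close>
  inner edges; the bound is its value at the empty graph, where \<open>k * card W\<close> chances
  are left.\<close>

lemma seq_avg_dense_le:
  assumes "W \<subseteq> {1..n}"
  shows "seq_avg n N (\<lambda>vs. of_bool (a \<le> card (G vs \<inter> W \<times> W) div 2)) \<le>
           real (k * card W choose a) * (real (card W) / real (n - k)) ^ a"
proof -
  let ?p = "real (card W) / real (n - k)"
  let ?\<Psi> = "\<lambda>vs. edge_potential k W a ?p (G vs)"
  have "seq_avg n N (\<lambda>vs. of_bool (a \<le> card (G vs \<inter> W \<times> W) div 2)) \<le> seq_avg n N ?\<Psi>"
    by (rule seq_avg_mono) (auto simp: edge_potential_def)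
  also have "\<dots> \<le> ?\<Psi> []"
  proof (rule seq_avg_supermartingale)
    fix vs assume "set vs \<subseteq> {1..n}"
    then have "(\<Sum>v\<in>{1..n}. ?\<Psi> (vs @ [v])) \<le> real n * ?\<Psi> vs"
      using edge_potential_step[of "{1..n}" k "G vs" "u vs" W ?p a] sgraph_G move_in k_less assms
      by simp
    then show "(\<Sum>v\<in>{1..n}. ?\<Psi> (vs @ [v])) / real n \<le> ?\<Psi> vs"
      using k_less by (simp add: divide_simps mult.commute)
  qed
  also have "\<dots> = real (k * card W choose a) * ?p ^ a"
    by (simp add: edge_potential_def mult.commute)
  finally show ?thesis .
qed

definition bads :: "nat list \<Rightarrow> nat" where
  "bads vs = (\<Sum>i<length vs. of_bool (bad_round k (u (take i vs)) (vs ! i) (G (take i vs))))"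

lemma bads_Nil [simp]: "bads [] = 0"
  by (simp add: bads_def)

lemma bads_snoc [simp]: "bads (vs @ [v]) = bads vs + of_bool (bad_round k (u vs) v (G vs))"
  by (auto simp: bads_def nth_append intro!: sum.cong)

lemma seq_avg_bads_le: "seq_avg n N (\<lambda>vs. real (bads vs)) \<le> real N * real k / real n"
proof (induction N)
  case (Suc N)
  have n: "n > 0" using k_less by simp
  have "(\<Sum>v\<in>{1..n}. real (bads (vs @ [v]))) / real n \<le> real (bads vs) + real k / real n"
    if vs: "set vs \<subseteq> {1..n}" for vs
  proof -
    have "(\<Sum>v\<in>{1..n}. real (bads (vs @ [v]))) =
        real n * real (bads vs) + (\<Sum>v\<in>{1..n}. if bad_round k (u vs) v (G vs) then 1 else 0)"
      by (simp add: sum.distrib of_bool_def if_distrib[of real] cong: if_cong)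
    also have "(\<Sum>v\<in>{1..n}. if bad_round k (u vs) v (G vs) then 1 else 0) =
        real (card {v\<in>{1..n}. bad_round k (u vs) v (G vs)})"
      by (simp flip: sum.inter_filter)
    also have "real n * real (bads vs) + \<dots> \<le> real n * real (bads vs) + real k"
      using card_bad_round_le[OF _ sgraph_G[OF vs]] by simp
    finally show ?thesis using n by (simp add: divide_simps mult.commute)
  qed
  then have "seq_avg n (Suc N) (\<lambda>vs. real (bads vs)) \<le>
      seq_avg n N (\<lambda>vs. real (bads vs) + real k / real n)"
    unfolding seq_avg.simps by (intro seq_avg_mono) blast
  also have "\<dots> \<le> real (Suc N) * real k / real n"
    unfolding seq_avg_add seq_avg_const[OF n] using Suc by (simp add: add_divide_distrib ring_distribs)
  finally show ?case .
qed simp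

text \<open>Markov's inequality. The factor 2 is the deficit that one bad round can cause: one unit
  at the wished vertex and one at the drawn vertex.\<close>

lemma seq_avg_many_bads_le:
  assumes "r > 0"
  shows "seq_avg n N (\<lambda>vs. of_bool (r \<le> 2 * bads vs)) \<le> 2 * real N * real k / (real n * real r)"
proof -
  have "seq_avg n N (\<lambda>vs. of_bool (r \<le> 2 * bads vs)) \<le> seq_avg n N (\<lambda>vs. 2 / real r * real (bads vs))"
  proof (rule seq_avg_mono)
    fix vs
    show "of_bool (r \<le> 2 * bads vs) \<le> 2 / real r * real (bads vs)"
      using assms by (auto simp: of_bool_def divide_simps)
  qed
  also have "\<dots> \<le> 2 / real r * (real N * real k / real n)"
    unfolding seq_avg_cmult using seq_avg_bads_le by (intro mult_left_mono) auto
  finally show ?thesis by (simp add: mult_ac)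
qed

end

section \<open>Reaching minimum degree with delayed replies\<close>

text \<open>Redirecting saturated wishes to a deficient vertex lets every round that is not bad
  reduce the total deficit. The value 1 occurs only when no vertex is deficient.\<close>

definition pick :: "nat \<Rightarrow> nat \<Rightarrow> nat \<Rightarrow> nat rel \<Rightarrow> nat" where
  "pick n k w E =
     (if w \<in> {1..n} \<and> card (E `` {w}) < k then w
      else if \<exists>x\<in>{1..n}. card (E `` {x}) < k then SOME x. x \<in> {1..n} \<and> card (E `` {x}) < k
      else 1)"

text \<open>The recursion is on the reversed sequence, as rounds are appended at the end.\<close>

primrec rev_graph :: "nat \<Rightarrow> nat \<Rightarrow> (nat list \<Rightarrow> nat) \<Rightarrow> nat list \<Rightarrow> nat rel" where
  "rev_graph n k wish [] = {}"
| "rev_graph n k wish (v # vs) =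
     low_step k (pick n k (wish (rev vs)) (rev_graph n k wish vs)) v (rev_graph n k wish vs)"

definition pick_graph :: "nat \<Rightarrow> nat \<Rightarrow> (nat list \<Rightarrow> nat) \<Rightarrow> nat list \<Rightarrow> nat rel" where
  "pick_graph n k wish vs = rev_graph n k wish (rev vs)"

definition pick_move :: "nat \<Rightarrow> nat \<Rightarrow> (nat list \<Rightarrow> nat) \<Rightarrow> nat list \<Rightarrow> nat" where
  "pick_move n k wish vs = pick n k (wish vs) (pick_graph n k wish vs)"

lemma pick_some:
  assumes "\<exists>x\<in>{1..n}. card (E `` {x}) < k"
  shows "pick n k w E \<in> {1..n} \<and> card (E `` {pick n k w E}) < k"
proof -
  have "\<exists>x. x \<in> {1..n} \<and> card (E `` {x}) < k" using assms by auto
  from someI_ex[OF this] show ?thesis using assms by (auto simp: pick_def)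
qed

lemma pick_in: "n > 0 \<Longrightarrow> pick n k w E \<in> {1..n}"
  using pick_some[of n E k w] by (cases "\<exists>x\<in>{1..n}. card (E `` {x}) < k") (auto simp: pick_def)

lemma pick_wish: "w \<in> {1..n} \<Longrightarrow> card (E `` {w}) < k \<Longrightarrow> pick n k w E = w"
  by (simp add: pick_def)

lemma low_process_pick:
  assumes "k < n"
  shows "low_process n k (pick_move n k wish) (pick_graph n k wish)"
  using assms pick_in[of n k] by unfold_locales (auto simp: pick_move_def pick_graph_def)

text \<open>If the wish \<open>w\<close> is still deficient, then \<open>u = w\<close> and a round
  that is not bad raises degrees exactly where demand rises. If \<open>w\<close> is saturated, its
  truncated deficit is 0 anyway. A bad round adds at most the two new demands.\<close>

lemma demand_step:
  assumes E: "sgraph {1..n} E" and w: "w \<in> {1..n}" and v: "v \<in> {1..n}"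
    and u: "u = pick n k w E"
  shows "(\<Sum>x\<in>{1..n}. min k (D x + of_bool (w = x) + of_bool (v = x))
             - card (low_step k u v E `` {x})) \<le>
           (\<Sum>x\<in>{1..n}. min k (D x) - card (E `` {x})) + 2 * of_bool (bad_round k u v E)"
proof -
  let ?V = "{1..n}"
  let ?d = "\<lambda>x. card (E `` {x})" and ?d' = "\<lambda>x. card (low_step k u v E `` {x})"
  let ?D' = "\<lambda>x. D x + of_bool (w = x) + of_bool (v = x)"
  have n: "n > 0" using w by auto
  have uV: "u \<in> ?V" using pick_in[OF n] u by simp
  have le: "?d x \<le> ?d' x" for x
    using degree_mono[OF _ sgraph_low_step[OF E uV v] low_step_mono] by simp
  consider "k \<le> ?d u" | "bad_round k u v E" | "?d u < k" "\<not> bad_round k u v E"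
    by linarith
  then show ?thesis
  proof cases
    case 1
    then have "\<forall>x\<in>?V. k \<le> ?d x" using pick_some[of n E k w] u by (metis not_le)
    then have "min k (?D' x) - ?d' x = 0" if "x \<in> ?V" for x
      using le[of x] that by (metis diff_is_0_eq min.coboundedI1 order.trans)
    then show ?thesis by simp
  next
    case 2
    have "(\<Sum>x\<in>?V. min k (?D' x) - ?d' x) \<le>
      (\<Sum>x\<in>?V. (min k (D x) - ?d x) + (of_bool (w = x) + of_bool (v = x)))"
    proof (rule sum_mono)
      fix x
      show "min k (?D' x) - ?d' x \<le> (min k (D x) - ?d x) + (of_bool (w = x) + of_bool (v = x))"
        using le[of x] by (auto simp: min_def)
    qed
    also have "\<dots> = (\<Sum>x\<in>?V. min k (D x) - ?d x) + 2"
      using w v by (simp add: sum.distrib of_bool_def)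
    finally show ?thesis using 2 by simp
  next
    case 3
    have d': "?d' x = ?d x + of_bool (x = u) + of_bool (x = v)" for x
      using low_step_degree[OF _ E 3] by simp
    have "v \<noteq> u" using 3 by (auto simp: bad_round_def)
    have "min k (?D' x) - ?d' x \<le> min k (D x) - ?d x" for x
    proof (cases "?d w < k")
      case True
      then have "u = w" using pick_wish[OF w] u by simp
      then show ?thesis using \<open>v \<noteq> u\<close> d'[of x] by (auto simp: min_def)
    next
      case False
      then show ?thesis using d'[of x] by (cases "x = w") (auto simp: min_def)
    qed
    then show ?thesis by (intro trans_le_add1 sum_mono)
  qed
qed

text \<open>While some vertex is deficient, so is the chosen one; hence only bad rounds fail to
  reduce the total deficit.\<close>

lemma deficit_step:
  assumes E: "sgraph {1..n} E" and v: "v \<in> {1..n}" and u: "u = pick n k w E"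
    and pos: "(\<Sum>x\<in>{1..n}. k - card (E `` {x})) > 0"
  shows "(\<Sum>x\<in>{1..n}. k - card (low_step k u v E `` {x})) + 1 \<le>
           (\<Sum>x\<in>{1..n}. k - card (E `` {x})) + of_bool (bad_round k u v E)"
proof -
  have "\<exists>x\<in>{1..n}. card (E `` {x}) < k"
    using pos by (metis (no_types, lifting) diff_is_0_eq less_numeral_extra(3) not_le sum.neutral)
  from pick_some[OF this] u have uV: "u \<in> {1..n}" and low: "card (E `` {u}) < k" by auto
  show ?thesis
  proof (cases "bad_round k u v E")
    case True
    then have "low_step k u v E = E"
      by (intro low_step_same[OF E]) (auto simp: bad_round_def)
    then show ?thesis using True by simp
  next
    case False
    note d' = low_step_degree[OF _ E low False]
    have "(\<Sum>x\<in>{1..n}. k - card (low_step k u v E `` {x})) < (\<Sum>x\<in>{1..n}. k - card (E `` {x}))"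
      using uV low by (intro sum_strict_mono_ex1) (auto simp: d' intro!: bexI[of _ u])
    then show ?thesis using False by simp
  qed
qed

text \<open>How often \<open>x\<close> has been wished for or drawn, that is, its degree if no round were wasted.\<close>

definition demand :: "(nat list \<Rightarrow> nat) \<Rightarrow> nat list \<Rightarrow> nat \<Rightarrow> nat" where
  "demand wish vs x =
     (\<Sum>i<length vs. of_bool (wish (take i vs) = x) + of_bool (vs ! i = x))"

lemma demand_Nil [simp]: "demand wish [] x = 0"
  by (simp add: demand_def)

lemma demand_snoc [simp]:
  "demand wish (vs @ [v]) x = demand wish vs x + of_bool (wish vs = x) + of_bool (v = x)"
  by (auto simp: demand_def nth_append intro!: sum.cong)

lemma demand_deficit_le:
  assumes "k < n" "\<And>xs. wish xs \<in> {1..n}" "set vs \<subseteq> {1..n}"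
  shows "(\<Sum>x\<in>{1..n}. min k (demand wish vs x) - card (pick_graph n k wish vs `` {x})) \<le>
           2 * low_process.bads k (pick_move n k wish) (pick_graph n k wish) vs"
proof -
  interpret low_process n k "pick_move n k wish" "pick_graph n k wish"
    using low_process_pick[OF assms(1)] .
  show ?thesis using assms(3)
  proof (induction vs rule: rev_induct)
    case (snoc v vs)
    then show ?case
      using demand_step[OF sgraph_G assms(2), of vs v "pick_move n k wish vs" k vs "demand wish vs"]
      unfolding demand_snoc G_snoc bads_snoc by (simp add: pick_move_def[of n k wish vs])
  qed simp
qed

text \<open>Once all demands reach \<open>k\<close>, the deficit is at most twice the number of bad
  rounds; the remaining \<open>r\<close> rounds work it off.\<close>

lemma pick_graph_min_degree:
  assumes "k < n" "\<And>xs. wish xs \<in> {1..n}" "set vs \<subseteq> {1..n}" "length vs = L + r"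
    and demand: "\<forall>x\<in>{1..n}. k \<le> demand wish (take L vs) x"
    and bads: "2 * low_process.bads k (pick_move n k wish) (pick_graph n k wish) vs < r"
    and x: "x \<in> {1..n}"
  shows "k \<le> card (pick_graph n k wish vs `` {x})"
proof -
  interpret low_process n k "pick_move n k wish" "pick_graph n k wish"
    using low_process_pick[OF assms(1)] .
  let ?F = "\<lambda>vs. \<Sum>x\<in>{1..n}. k - card (pick_graph n k wish vs `` {x})"
  \<comment> \<open>Deficit 0 persists by monotonicity. Otherwise a bad round raises the left side
    by 1 and the right side by 2, and any other round does not raise the left side.\<close>
  have "?F (take (L + j) vs) = 0 \<or> ?F (take (L + j) vs) + j \<le> 2 * bads (take (L + j) vs)"
    if "j \<le> r" for j
    using that
  proof (induction j)
    case 0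
    have "?F (take L vs) \<le> 2 * bads (take L vs)"
      using demand_deficit_le[where wish = wish, OF assms(1,2), of "take L vs"] demand assms(3) set_take_subset[of L vs]
      by (simp add: min_absorb1)
    then show ?case by simp
  next
    case (Suc j)
    let ?ys = "take (L + j) vs" and ?v = "vs ! (L + j)"
    have eq: "take (L + Suc j) vs = ?ys @ [?v]"
      using Suc.prems assms(4) by (simp add: take_Suc_conv_app_nth)
    have ys: "set ?ys \<subseteq> {1..n}"
      using set_take_subset[of "L + j" vs] assms(3) by blast
    have v: "?v \<in> {1..n}"
      using assms(3,4) Suc.prems by (intro subsetD[OF assms(3)] nth_mem) auto
    note E = sgraph_G[OF ys]
    show ?case
    proof (cases "?F ?ys = 0")
      case True
      have "?F (?ys @ [?v]) \<le> ?F ?ys"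
        using degree_mono[OF _ sgraph_low_step[OF E move_in v] low_step_mono]
        by (auto intro!: sum_mono diff_le_mono2)
      then show ?thesis using True unfolding eq by simp
    next
      case False
      then have "?F (?ys @ [?v]) + 1 \<le> ?F ?ys +
          of_bool (bad_round k (pick_move n k wish ?ys) ?v (pick_graph n k wish ?ys))"
        unfolding G_snoc by (intro deficit_step[OF E v]) (auto simp only: pick_move_def)
      moreover have "?F ?ys + j \<le> 2 * bads ?ys"
        using False Suc by linarith
      moreover have "a + Suc j \<le> 2 * (b + c)" if "a + 1 \<le> f + c" "f + j \<le> 2 * b" for a b c f :: nat
        using that by simp
      ultimately show ?thesis unfolding eq bads_snoc by blast
    qed
  qed
  from this[of r] have "?F vs = 0" using bads assms(4) by auto
  then show ?thesis using x by simp
qed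

section \<open>From neighbours in the simulated run to demands\<close>

lemma card_neighbours_le:
  "card (neighbours V (edges_of hist) x) \<le>
     length (filter (\<lambda>e. fst e = x) hist) + length (filter (\<lambda>e. snd e = x) hist)"
proof -
  have "neighbours V (edges_of hist) x \<subseteq>
      snd ` set (filter (\<lambda>e. fst e = x) hist) \<union> fst ` set (filter (\<lambda>e. snd e = x) hist)"
    by (force simp: neighbours_def edges_of_def)
  then have "card (neighbours V (edges_of hist) x) \<le>
      card (snd ` set (filter (\<lambda>e. fst e = x) hist) \<union> fst ` set (filter (\<lambda>e. snd e = x) hist))"
    by (intro card_mono) auto
  also have "\<dots> \<le> card (snd ` set (filter (\<lambda>e. fst e = x) hist)) +
      card (fst ` set (filter (\<lambda>e. snd e = x) hist))"
    by (rule card_Un_le)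
  also have "\<dots> \<le> length (filter (\<lambda>e. fst e = x) hist) + length (filter (\<lambda>e. snd e = x) hist)"
    by (intro add_mono) (metis card_length length_map list.set_map)+
  finally show ?thesis .
qed

text \<open>The reply of \<open>d\<close> to the last vertex of \<open>vs\<close>, to be used in the round after \<open>vs\<close>.\<close>

definition delayed_reply :: "((nat \<times> nat) list \<Rightarrow> nat \<Rightarrow> nat) \<Rightarrow> nat list \<Rightarrow> nat" where
  "delayed_reply d vs = (if vs = [] then 1 else fst (last (det_history d vs)))"

lemma delayed_reply_snoc [simp]: "delayed_reply d (vs @ [v]) = d (det_history d vs) v"
  by (simp add: delayed_reply_def)

lemma delayed_reply_in:
  assumes "n > 0" "\<And>hist v. d hist v \<in> {1..n}"
  shows "delayed_reply d vs \<in> {1..n}"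
  using assms by (cases vs rule: rev_cases) (auto simp: delayed_reply_def[of d "[]"])

text \<open>The extra vertex \<open>v\<close> provides the round in which the reply to the last
  vertex of \<open>vs\<close> is wished for. The arbitrary first wish 1 is surplus, hence an
  inequality.\<close>

lemma demand_delayed_reply:
  "length (filter (\<lambda>e. fst e = x) (det_history d vs)) +
     length (filter (\<lambda>e. snd e = x) (det_history d vs)) + of_bool (v = x) \<le>
   demand (delayed_reply d) (vs @ [v]) x"
proof (induction vs arbitrary: v rule: rev_induct)
  case (snoc w ws)
  show ?case
    using snoc.IH[of w] unfolding demand_snoc det_history_snoc delayed_reply_snoc
    by (auto simp: of_bool_def)
next
  case Nil
  show ?case using demand_snoc[of "delayed_reply d" "[]" v x] by simp
qed

lemma demand_of_min_neighbours:
  assumes "min_neighbours k V (edges_of (det_history d vs))" "x \<in> V"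
  shows "k \<le> demand (delayed_reply d) (vs @ [v]) x"
  using assms card_neighbours_le[of V "det_history d vs" x] demand_delayed_reply[of x d vs v]
  by (fastforce simp: min_neighbours_def)

section \<open>Sparse small sets and hubs give connectivity\<close>

text \<open>Here \<open>s = |S|\<close>, \<open>t = |N(S)|\<close>, and \<open>e / 2\<close> and \<open>f\<close> are the numbers of edges inside \<open>S\<close> and
  between \<open>S\<close> and \<open>N(S)\<close>.\<close>

lemma dense_arith:
  fixes k s t e f m :: nat
  assumes "3 \<le> k" "0 < s" "t < k" "k * s \<le> e + f" "e + s \<le> s * s" "t \<le> f" "k + 1 \<le> s + t"
    and m: "m = s + t"
  shows "m + m div (4 * k) + 1 \<le> (e + 2 * f) div 2"
proof -
  have ks: "k * s + t \<le> e + 2 * f" using assms by linarith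
  have "3 * s \<le> k * s" using assms(1) by simp
  then have big: "3 * s + t \<le> e + 2 * f" using ks by linarith
  show ?thesis
  proof (cases "m < 4 * k")
    case True
    have "2 * m + 2 \<le> e + 2 * f"
    proof (cases "t + 2 \<le> s")
      case True
      then show ?thesis using big m by linarith
    next
      case False
      \<comment> \<open>Twice the degree bound \<open>k * s \<le> e + f\<close>, minus
        \<open>e \<le> s * s - s\<close>.\<close>
      have e2: "2 * (k * s) + s \<le> e + 2 * f + s * s" using assms(4,5) by linarith
      show ?thesis
      proof (cases "s \<le> 2")
        case True
        \<comment> \<open>The value \<open>s = 1\<close> would force
          \<open>t \<ge> k\<close>.\<close>
        then have "s = 2" using assms by auto
        then show ?thesis using e2 assms by simp
      next
        case s3: False
        obtain c where c: "t + 1 = s + c" using False by (metis Suc_eq_plus1 add_2_eq_Suc' le_Suc_ex not_less_eq_eq)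
        have "(s + c) * s \<le> k * s" using c assms(3) by (intro mult_right_mono) auto
        then have "s * s + 2 * (c * s) + s \<le> e + 2 * f" using e2 by (simp add: algebra_simps)
        moreover have "3 * s \<le> s * s" using s3 by simp
        moreover have "c \<le> c * s" using assms(2) by simp
        ultimately have "4 * s + 2 * c \<le> e + 2 * f" by linarith
        then show ?thesis using c m by linarith
      qed
    qed
    then show ?thesis using True by simp
  next
    case False
    \<comment> \<open>For \<open>m \<ge> 4 * k\<close> the bound
      \<open>3 * s + t = 3 * m - 2 * t\<close> with \<open>t < k \<le> m / 4\<close> leaves enough
      room.\<close>
    have "m div (4 * k) \<le> m div 12" using assms(1) by (intro div_le_mono2) auto
    then show ?thesis using False big m assms(3) by linarith
  qed
qed

text \<open>The degrees in \<open>S\<close> sum to \<open>e + f\<close>. Each pair from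
  \<open>S\<close> to \<open>T\<close> also occurs reversed, so \<open>W\<close> contains at least
  \<open>e + 2 * f\<close> ordered pairs, and \<open>dense_arith\<close> applies.\<close>

lemma dense_of_small_neighbourhood:
  assumes V: "finite V" and E: "sgraph V E" and k: "3 \<le> k"
    and S: "S \<subseteq> V" "S \<noteq> {}" "\<And>x. x \<in> S \<Longrightarrow> k \<le> card (E `` {x})"
    and T: "T = E `` S - S" "card T < k" and W: "W = S \<union> T"
  shows "card W + card W div (4 * k) + 1 \<le> card (E \<inter> W \<times> W) div 2"
proof -
  have finE: "finite E" using finite_sgraph[OF V E] .
  have fin: "finite S" "finite T"
    using S V finE T by (auto intro: finite_subset)
  have sym: "(y, x) \<in> E" if "(x, y) \<in> E" for x y using E that by (auto simp: sgraph_def sym_def)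
  have irr: "(x, x) \<notin> E" for x using E by (auto simp: sgraph_def irrefl_def)
  let ?e = "card (E \<inter> S \<times> S)" and ?f = "card (E \<inter> S \<times> T)"
  have deg: "(\<Sum>x\<in>S. card (E `` {x})) = ?e + ?f"
  proof -
    have "(\<Sum>x\<in>S. card (E `` {x})) = card (SIGMA x:S. E `` {x})"
      using fin finE by (subst card_SigmaI) auto
    also have "(SIGMA x:S. E `` {x}) = (E \<inter> S \<times> S) \<union> (E \<inter> S \<times> T)"
      unfolding T by auto
    also have "card \<dots> = ?e + ?f" using finE T by (intro card_Un_disjoint) auto
    finally show ?thesis .
  qed
  have "card S * k \<le> (\<Sum>x\<in>S. card (E `` {x}))" 
    using sum_mono[of S "\<lambda>_. k", OF S(3)] by simp
  then have h1: "k * card S \<le> ?e + ?f" using deg by (simp add: mult.commute)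
  have h2: "?e + card S \<le> card S * card S"
  proof -
    have "?e + card S = card (E \<inter> S \<times> S) + card (Id_on S)"
      using fin by (simp add: Id_on_def card_UN_disjoint)
    also have "\<dots> = card ((E \<inter> S \<times> S) \<union> Id_on S)"
      using finE fin irr by (intro card_Un_disjoint[symmetric]) (auto simp: Id_on_def)
    also have "\<dots> \<le> card (S \<times> S)" using fin by (intro card_mono) auto
    finally show ?thesis by (simp add: card_cartesian_product)
  qed
  have h3: "card T \<le> ?f"
  proof -
    have "T \<subseteq> snd ` (E \<inter> S \<times> T)" unfolding T by force
    then show ?thesis using finE by (meson card_image_le card_mono finite_Int finite_imageI order.trans)
  qed
  have h4: "?e + 2 * ?f \<le> card (E \<inter> W \<times> W)"
  proof -
    have "card (E \<inter> T \<times> S) = ?f"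
      by (intro bij_betw_same_card[of prod.swap] bij_betw_byWitness[where f' = prod.swap])
         (auto intro: sym)
    then have "?e + 2 * ?f = card (E \<inter> S \<times> S) + card (E \<inter> S \<times> T) + card (E \<inter> T \<times> S)" by simp
    also have "\<dots> = card ((E \<inter> S \<times> S \<union> E \<inter> S \<times> T) \<union> E \<inter> T \<times> S)"
      using finE T by (subst card_Un_disjoint, auto)+
    also have "\<dots> \<le> card (E \<inter> W \<times> W)" using finE W by (intro card_mono) auto
    finally show ?thesis .
  qed
  have mW: "card W = card S + card T"
    unfolding W using fin T by (intro card_Un_disjoint) auto
  have h5: "k + 1 \<le> card S + card T"
  proof -
    obtain x where x: "x \<in> S" using S(2) by auto
    have "E `` {x} \<subseteq> W - {x}" using x irr unfolding W T by auto
    then have "card (E `` {x}) \<le> card (W - {x})" using fin W by (intro card_mono) auto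
    moreover have "card (W - {x}) + 1 = card W" using x W fin
      by (metis Suc_eq_plus1 UnI1 card_Suc_Diff1 finite_UnI)
    ultimately show ?thesis using S(3)[OF x] mW by linarith
  qed
  have "card S > 0" using S(2) fin by (simp add: card_gt_0_iff)
  from dense_arith[OF k this T(2) h1 h2 h3 h5 mW] h4
  show ?thesis by (meson div_le_mono order.trans)
qed

section \<open>Components left after deleting few vertices\<close>

definition component :: "'a set \<Rightarrow> 'a rel \<Rightarrow> 'a \<Rightarrow> 'a set" where
  "component U E x = {y. (x, y) \<in> (E \<inter> U \<times> U)\<^sup>*}"

lemma component_subset: "x \<in> U \<Longrightarrow> component U E x \<subseteq> U"
  by (auto simp: component_def elim: rtranclE)

text \<open>All neighbours of the component outside it lie in \<open>T\<close>. A smaller component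
  would form, with these neighbours, a dense set of at most \<open>L\<close> vertices.\<close>

lemma large_component:
  assumes V: "finite V" and E: "sgraph V E" and k: "3 \<le> k"
    and deg: "\<And>x. x \<in> V \<Longrightarrow> k \<le> card (E `` {x})"
    and sparse: "\<And>W. W \<subseteq> V \<Longrightarrow> W \<noteq> {} \<Longrightarrow> card W \<le> L \<Longrightarrow>
      card (E \<inter> W \<times> W) div 2 < card W + card W div (4 * k) + 1"
    and T: "T \<subseteq> V" "card T < k" and x: "x \<in> V - T"
  shows "L < card (component (V - T) E x) + k"
proof (rule ccontr)
  define S where "S = component (V - T) E x"
  assume "\<not> ?thesis"
  then have L: "card S + k \<le> L" by (simp add: S_def)
  have S: "S \<subseteq> V - T" unfolding S_def by (rule component_subset[OF x])
  have xS: "x \<in> S" by (simp add: S_def component_def)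
  have closed: "E `` S \<subseteq> S \<union> T"
  proof (clarify)
    fix y z assume "y \<in> S" "(y, z) \<in> E" "z \<notin> T"
    moreover have "y \<in> V - T" "z \<in> V" using S E calculation by (auto simp: sgraph_def)
    ultimately have "(y, z) \<in> E \<inter> (V - T) \<times> (V - T)" by auto
    with \<open>y \<in> S\<close> show "z \<in> S"
      unfolding S_def component_def by (auto intro: rtrancl_into_rtrancl)
  qed
  define T' where "T' = E `` S - S"
  have fT: "finite T" using T V finite_subset by blast
  have T': "T' \<subseteq> T" using closed by (auto simp: T'_def)
  then have cT: "card T' < k" using card_mono[OF fT T'] T(2) by linarith
  have "card (S \<union> T') + card (S \<union> T') div (4 * k) + 1 \<le> card (E \<inter> (S \<union> T') \<times> (S \<union> T')) div 2"
    using S xS deg cT by (intro dense_of_small_neighbourhood[OF V E k _ _ _ T'_def]) auto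
  moreover have "card (S \<union> T') \<le> L"
    using card_Un_le[of S T'] cT L by linarith
  ultimately show False using sparse[of "S \<union> T'"] S T' T xS by fastforce
qed

text \<open>\<open>E\<close> will be the graph before the hub rounds and \<open>M\<close> the final
  multigraph. Using components of \<open>E\<close> keeps them independent of the hub edges. Some hub
  survives the deletion, and every vertex reaches it through its component.\<close>

lemma vertex_connected_by_hubs:
  assumes V: "finite V" and E: "sgraph V E" and k: "3 \<le> k" "k < card V"
    and deg: "\<And>x. x \<in> V \<Longrightarrow> k \<le> card (E `` {x})"
    and sparse: "\<And>W. W \<subseteq> V \<Longrightarrow> W \<noteq> {} \<Longrightarrow> card W \<le> L \<Longrightarrow>
      card (E \<inter> W \<times> W) div 2 < card W + card W div (4 * k) + 1"
    and EM: "\<And>x y. (x, y) \<in> E \<Longrightarrow> Upair x y \<in># M"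
    and H: "H \<subseteq> V" "k \<le> card H"
    and hubs: "\<And>T x j. T \<subseteq> V \<Longrightarrow> card T < k \<Longrightarrow> x \<in> V - T \<Longrightarrow> j \<in> H \<Longrightarrow>
      L < card (component (V - T) E x) + k \<Longrightarrow> \<exists>v\<in>component (V - T) E x. Upair j v \<in># M"
  shows "vertex_connected k V M"
  unfolding vertex_connected_def
proof (intro conjI allI impI)
  fix T assume T: "T \<subseteq> V \<and> card T < k"
  have fin: "finite T" "finite H" using T H V finite_subset by blast+
  obtain j where j: "j \<in> H" "j \<notin> T"
  proof -
    have "\<not> H \<subseteq> T" using card_mono[OF fin(1), of H] T H by linarith
    then show ?thesis using that by auto
  qed
  define R where "R = {(a, b). a \<in> V - T \<and> b \<in> V - T \<and> Upair a b \<in># M}"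
  have symR: "sym (R\<^sup>*)"
    by (intro sym_rtrancl) (auto simp: R_def sym_def, metis Upair_inject)
  have reach: "(x, j) \<in> R\<^sup>*" if x: "x \<in> V - T" for x
  proof -
    obtain v where v: "v \<in> component (V - T) E x" "Upair j v \<in># M"
      using hubs[OF _ _ x j(1) large_component[OF V E k(1) deg sparse _ _ x]] T by blast
    have "(x, v) \<in> R\<^sup>*"
      using v(1) unfolding component_def mem_Collect_eq
      by (rule rtrancl_mono[THEN subsetD, rotated]) (auto simp: R_def EM)
    moreover have "(j, v) \<in> R"
      using v j H component_subset[OF x, of E] by (auto simp: R_def)
    ultimately show ?thesis
      using symR by (meson r_into_rtrancl rtrancl_trans symD)
  qed
  show "connected_on (V - T) M"
    unfolding connected_on_def R_def[symmetric]
  proof (intro conjI ballI)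
    show "V - T \<noteq> {}" using j H by auto
    fix x y assume "x \<in> V - T" "y \<in> V - T"
    then show "(x, y) \<in> R\<^sup>*"
      using reach symR by (meson rtrancl_trans symD)
  qed
qed (use k in auto)

text \<open>Deleting fewer than \<open>k\<close> neighbours of \<open>x\<close> would isolate
  \<open>x\<close>, while \<open>k < card V\<close> leaves another vertex.\<close>

lemma vertex_connected_imp_min_neighbours:
  assumes V: "finite V" and conn: "vertex_connected k V M"
  shows "min_neighbours k V M"
  unfolding min_neighbours_def
proof (rule ballI, rule ccontr)
  fix x assume x: "x \<in> V" and "\<not> k \<le> card (neighbours V M x)"
  define S where "S = neighbours V M x"
  have S: "S \<subseteq> V" "card S < k" "x \<notin> S"
    using \<open>\<not> _\<close> by (auto simp: S_def neighbours_def)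
  have c: "connected_on (V - S) M" "k < card V"
    using conn S by (auto simp: vertex_connected_def)
  have "\<not> V \<subseteq> insert x S"
    using card_mono[of "insert x S" V] S V c(2) finite_subset[OF S(1) V]
    by (auto simp: card_insert_if)
  then obtain y where y: "y \<in> V - S" "y \<noteq> x" by auto
  define R where "R = {(a, b). a \<in> V - S \<and> b \<in> V - S \<and> Upair a b \<in># M}"
  have "(x, y) \<in> R\<^sup>*" using c(1) x y S unfolding connected_on_def R_def by blast
  then obtain z where "(x, z) \<in> R" "z \<noteq> x"
    using y(2) by (induction rule: rtrancl_induct) auto
  then show False by (auto simp: R_def S_def neighbours_def)
qed

section \<open>Probability bounds\<close>

text \<open>\<open>m ^ m / fact m\<close> is one term of the series for
  \<open>exp m\<close>.\<close>

lemma power_self_le: "real m ^ m \<le> 3 ^ m * fact m"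
proof -
  have "real m ^ m /\<^sub>R fact m \<le> exp (real m)"
    using sum_le_suminf[OF sums_summable[OF exp_converges[of "real m"]], of "{m}"]
      sums_unique[OF exp_converges[of "real m"]] by simp
  also have "exp (real m) = exp 1 ^ m" by (simp flip: exp_of_nat_mult)
  also have "\<dots> \<le> 3 ^ m" using exp_le by (intro power_mono) auto
  finally show ?thesis by (simp add: field_simps)
qed

text \<open>The union bound term for sets of size \<open>m\<close>. The \<open>m\<close> in
  \<open>a = m + q\<close> offsets the choice of the set up to a factor \<open>3 ^ m\<close>; the
  excess \<open>q\<close> yields the decay, as \<open>m / n\<close> is at most
  \<open>n powr (- 1 / 2)\<close>. The constant is \<open>2 ^ k * 4 * 3\<close>.\<close>

lemma dense_weight_le:
  fixes n k m :: nat
  defines "a \<equiv> m + m div (4 * k) + 1"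
  assumes k: "3 \<le> k" "2 * k \<le> n" and m: "1 \<le> m" "m * m \<le> n"
  shows "real (n choose m) * (real (k * m choose a) * (real m / real (n - k)) ^ a) \<le>
           (12 * 2 ^ k * real n powr (- 1 / (8 * real k))) ^ m"
proof -
  define q where "q = m div (4 * k) + 1"
  have a: "a = m + q" by (simp add: a_def q_def)
  have n: "n > 0" using k by simp
  have "m div (4 * k) \<le> m div 12" using k(1) by (intro div_le_mono2) auto
  then have qm: "q \<le> m" using m(1) unfolding q_def by linarith
  have c1: "real (n choose m) * fact m \<le> real n ^ m"
    using binomial_fact_pow[of n m] by (metis of_nat_fact of_nat_le_iff of_nat_mult of_nat_power)
  have c2: "real (k * m choose a) \<le> (2 ^ k) ^ m"
    using binomial_le_pow2[of "k * m" a]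
    by (metis of_nat_le_iff of_nat_numeral of_nat_power power_mult)
  have "real n \<le> 2 * real (n - k)" using k(2) by simp
  then have "real m / real (n - k) \<le> real m / (real n / 2)"
    using k n by (intro divide_left_mono) auto
  then have "real m / real (n - k) \<le> 2 * (real m / real n)" by (simp add: mult.commute)
  then have "(real m / real (n - k)) ^ a \<le> (2 * (real m / real n)) ^ a"
    by (intro power_mono) auto
  also have "\<dots> = 2 ^ a * ((real m / real n) ^ m * (real m / real n) ^ q)"
    by (simp only: a power_mult_distrib power_add mult_ac)
  also have "\<dots> \<le> 4 ^ m * ((real m / real n) ^ m * (real m / real n) ^ q)"
  proof (rule mult_right_mono)
    have "(2::real) ^ a \<le> 2 ^ (2 * m)" using qm a by (intro power_increasing) auto
    then show "(2::real) ^ a \<le> 4 ^ m" by (simp add: power_mult)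
  qed auto
  finally have c3: "(real m / real (n - k)) ^ a \<le>
      4 ^ m * ((real m / real n) ^ m * (real m / real n) ^ q)" .
  have c4: "(real m / real n) ^ q \<le> (real n powr (- 1 / (8 * real k))) ^ m"
  proof -
    have "real m * real m \<le> real n" using m(2) by (metis of_nat_le_iff of_nat_mult)
    then have "real m \<le> sqrt (real n)" by (simp add: real_le_rsqrt power2_eq_square)
    then have "real m / real n \<le> sqrt (real n) / real n" by (intro divide_right_mono) auto
    also have "sqrt (real n) / real n = real n powr (- 1 / 2)"
    proof -
      have e: "real n powr (- 1 / 2) = 1 / sqrt (real n)"
        using powr_minus_divide[of "real n" "1 / 2"] by (simp add: powr_half_sqrt)
      show ?thesis unfolding e using n by (simp add: field_simps)
    qed
    finally have "(real m / real n) ^ q \<le> (real n powr (- 1 / 2)) ^ q"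
      by (intro power_mono) auto
    also have "\<dots> = real n powr (- real q / 2)"
      using n by (simp add: powr_realpow[symmetric] powr_powr)
    also have "\<dots> \<le> real n powr (- real m / (8 * real k))"
    proof (rule powr_mono)
      \<comment> \<open>The excess \<open>q\<close> is more than \<open>m / (4 * k)\<close>, so the
        decay is exponential in \<open>m\<close>.\<close>
      have "m < 4 * k * q" unfolding q_def using k(1)
        by (metis Suc_eq_plus1 dividend_less_times_div mult.commute mult_Suc_right nat_0_less_mult_iff add.commute
            less_le_trans zero_less_numeral)
      then have "real m \<le> 4 * real k * real q" 
        by (metis less_imp_le of_nat_le_iff of_nat_mult of_nat_numeral)
      then show "- real q / 2 \<le> - real m / (8 * real k)" using k(1) by (simp add: field_simps)
    qed (use n in auto)
    also have "\<dots> = (real n powr (- 1 / (8 * real k))) ^ m"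
      using n by (simp add: powr_realpow[symmetric] powr_powr)
    finally show ?thesis .
  qed
  have c5: "real (n choose m) * (real m / real n) ^ m \<le> 3 ^ m"
  proof -
    have "real (n choose m) * (real m / real n) ^ m * fact m =
        (real (n choose m) * fact m) * (real m ^ m / real n ^ m)"
      by (simp add: power_divide)
    also have "\<dots> \<le> real n ^ m * (real m ^ m / real n ^ m)"
      using c1 by (intro mult_right_mono) auto
    also have "\<dots> = real m ^ m" using n by simp
    also have "\<dots> \<le> 3 ^ m * fact m" by (rule power_self_le)
    finally show ?thesis by simp
  qed
  have "real (n choose m) * (real (k * m choose a) * (real m / real (n - k)) ^ a) \<le>
      real (n choose m) * ((2 ^ k) ^ m * (4 ^ m * ((real m / real n) ^ m * (real m / real n) ^ q)))"
    by (intro mult_left_mono mult_mono c2 c3) auto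
  also have "\<dots> = (2 ^ k) ^ m * 4 ^ m * (real (n choose m) * (real m / real n) ^ m) * (real m / real n) ^ q"
    by (simp only: mult_ac)
  also have "\<dots> \<le> (2 ^ k) ^ m * 4 ^ m * 3 ^ m * (real n powr (- 1 / (8 * real k))) ^ m"
    by (intro mult_mono c4 c5 order_refl) auto
  also have "\<dots> = (12 * 2 ^ k * real n powr (- 1 / (8 * real k))) ^ m"
    by (simp add: power_mult_distrib flip: power_mult_distrib[of 4 3])
  finally show ?thesis .
qed

context low_process
begin

text \<open>Union bound over all sets, grouped by size, followed by a geometric series with ratio at
  most 1/2.\<close>

lemma seq_avg_some_dense_le:
  fixes L :: nat
  defines "\<rho> \<equiv> 12 * 2 ^ k * real n powr (- 1 / (8 * real k))"
  assumes k: "3 \<le> k" "2 * k \<le> n" and L: "L * L \<le> n" and \<rho>: "\<rho> \<le> 1 / 2"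
  shows "seq_avg n N (\<lambda>vs. of_bool (\<exists>W\<subseteq>{1..n}. W \<noteq> {} \<and> card W \<le> L \<and>
           card W + card W div (4 * k) + 1 \<le> card (G vs \<inter> W \<times> W) div 2)) \<le> 2 * \<rho>"
proof -
  let ?a = "\<lambda>m. m + m div (4 * k) + 1"
  let ?F = "\<lambda>m. {W. W \<subseteq> {1..n} \<and> card W = m}"
  let ?D = "\<lambda>m W vs. ?a m \<le> card (G vs \<inter> W \<times> W) div 2"
  have "seq_avg n N (\<lambda>vs. of_bool (\<exists>W\<subseteq>{1..n}. W \<noteq> {} \<and> card W \<le> L \<and>
           ?a (card W) \<le> card (G vs \<inter> W \<times> W) div 2)) \<le>
        seq_avg n N (\<lambda>vs. \<Sum>m=1..L. \<Sum>W\<in>?F m. of_bool (?D m W vs))"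
  proof (rule seq_avg_mono)
    fix vs
    show "of_bool (\<exists>W\<subseteq>{1..n}. W \<noteq> {} \<and> card W \<le> L \<and>
        ?a (card W) \<le> card (G vs \<inter> W \<times> W) div 2) \<le>
      (\<Sum>m=1..L. \<Sum>W\<in>?F m. of_bool (?D m W vs) :: real)" (is "of_bool ?P \<le> ?S")
    proof (cases ?P)
      case True
      then obtain W0 where W0: "W0 \<subseteq> {1..n}" "W0 \<noteq> {}" "card W0 \<le> L" "?D (card W0) W0 vs"
        by auto
      define m0 where "m0 = card W0"
      have m0: "m0 \<in> {1..L}"
        using W0 finite_subset[OF W0(1)] by (auto simp: m0_def Suc_le_eq card_gt_0_iff)
      have "(1::real) = of_bool (?D m0 W0 vs)" using W0(4) by (simp add: m0_def)
      also have "\<dots> \<le> (\<Sum>W\<in>?F m0. of_bool (?D m0 W vs))"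
        using W0(1) by (intro member_le_sum) (auto simp: m0_def)
      also have "\<dots> \<le> ?S"
        using m0 by (intro member_le_sum[where f = "\<lambda>m. \<Sum>W\<in>?F m. of_bool (?D m W vs)"])
          (auto intro: sum_nonneg)
      finally show ?thesis by simp
    qed (auto intro!: sum_nonneg)
  qed
  also have "\<dots> = (\<Sum>m=1..L. \<Sum>W\<in>?F m. seq_avg n N (\<lambda>vs. of_bool (?D m W vs)))"
    by (simp only: seq_avg_sum)
  also have "\<dots> \<le> (\<Sum>m=1..L. \<rho> ^ m)"
  proof (rule sum_mono)
    fix m assume m: "m \<in> {1..L}"
    have "(\<Sum>W\<in>?F m. seq_avg n N (\<lambda>vs. of_bool (?D m W vs))) \<le>
        (\<Sum>W\<in>?F m. real (k * m choose ?a m) * (real m / real (n - k)) ^ ?a m)"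
    proof (rule sum_mono)
      fix W assume "W \<in> ?F m"
      then have "W \<subseteq> {1..n}" "card W = m" by auto
      then show "seq_avg n N (\<lambda>vs. of_bool (?D m W vs)) \<le>
          real (k * m choose ?a m) * (real m / real (n - k)) ^ ?a m"
        using seq_avg_dense_le[of W N "?a m"] by simp
    qed
    also have "\<dots> = real (n choose m) * (real (k * m choose ?a m) * (real m / real (n - k)) ^ ?a m)"
      using n_subsets[of "{1..n}" m] by simp
    also have "\<dots> \<le> \<rho> ^ m"
      unfolding \<rho>_def using m k mult_le_mono[of m L m L] L
      by (intro dense_weight_le) auto
    finally show "(\<Sum>W\<in>?F m. seq_avg n N (\<lambda>vs. of_bool (?D m W vs))) \<le> \<rho> ^ m" .
  qed
  also have "\<dots> \<le> 2 * \<rho>"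
  proof -
    have "\<rho> \<ge> 0" by (simp add: \<rho>_def)
    \<comment> \<open>The subtracted term makes the induction go through.\<close>
    have "(\<Sum>m=1..L. \<rho> ^ m) \<le> 2 * \<rho> - 2 * \<rho> ^ Suc L"
    proof (induction L)
      case (Suc L)
      have "\<rho> ^ Suc L * \<rho> \<le> \<rho> ^ Suc L * (1 / 2)"
        using \<open>\<rho> \<ge> 0\<close> \<rho> by (intro mult_left_mono) auto
      then show ?case using Suc by (simp add: mult.commute)
    qed auto
    moreover have "0 \<le> \<rho> ^ Suc L" using \<open>\<rho> \<ge> 0\<close> by simp
    ultimately show ?thesis by linarith
  qed
  finally show ?thesis .
qed

end

text \<open>The target set is fixed by the first \<open>N \<le> a\<close> vertices, and each of the
  \<open>b\<close> later vertices misses it with probability at most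
  \<open>1 - c / n\<close>.\<close>

lemma seq_avg_avoid_le:
  assumes "n > 0" "c \<le> n"
    and A: "\<And>ys. P ys \<Longrightarrow> A ys \<subseteq> {1..n} \<and> c \<le> card (A ys)" and "N \<le> a"
  shows "seq_avg n (a + b) (\<lambda>vs. of_bool (P (take N vs) \<and> (\<forall>i\<in>{a..<a+b}. vs ! i \<notin> A (take N vs))))
           \<le> (1 - real c / real n) ^ b"
proof (induction b)
  case 0
  have "seq_avg n a (\<lambda>vs. of_bool (P (take N vs))) \<le> seq_avg n a (\<lambda>_. 1)"
    by (rule seq_avg_mono) auto
  then show ?case using seq_avg_const[OF assms(1)] by simp
next
  case (Suc b)
  let ?f = "\<lambda>b (vs :: nat list). of_bool (P (take N vs) \<and> (\<forall>i\<in>{a..<a+b}. vs ! i \<notin> A (take N vs))) :: real"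
  have "seq_avg n (a + Suc b) (?f (Suc b)) \<le>
      seq_avg n (a + b) (\<lambda>vs. (1 - real c / real n) * ?f b vs)"
    unfolding add_Suc_right seq_avg.simps
  proof (rule seq_avg_mono)
    fix vs :: "nat list" assume vs: "length vs = a + b"
    have take: "take N (vs @ [v]) = take N vs" for v using vs assms(4) by simp
    have "?f (Suc b) (vs @ [v]) = ?f b vs * of_bool (v \<notin> A (take N vs))" for v
      unfolding take using vs
      by (auto simp: nth_append atLeastLessThanSuc less_Suc_eq)
    then have "(\<Sum>v\<in>{1..n}. ?f (Suc b) (vs @ [v])) =
        ?f b vs * (\<Sum>v\<in>{1..n}. of_bool (v \<notin> A (take N vs)))"
      by (simp add: sum_distrib_left)
    also have "\<dots> \<le> ?f b vs * (real n - real c)"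
    proof (cases "P (take N vs)")
      case True
      note A' = A[OF True]
      have "(\<Sum>v\<in>{1..n}. of_bool (v \<notin> A (take N vs))) = real (card ({1..n} - A (take N vs)))"
        by (simp add: of_bool_def sum.If_cases set_diff_eq Int_def del: of_nat_sum)
      also have "\<dots> = real n - real (card (A (take N vs)))"
        using A' by (subst card_Diff_subset) (auto intro: finite_subset simp: of_nat_diff card_mono[of "{1..n}", simplified])
      also have "\<dots> \<le> real n - real c" using A' by simp
      finally show ?thesis by (intro mult_left_mono) auto
    qed simp
    finally have "(\<Sum>v\<in>{1..n}. ?f (Suc b) (vs @ [v])) \<le> ?f b vs * (real n - real c)" .
    then have "(\<Sum>v\<in>{1..n}. ?f (Suc b) (vs @ [v])) / real n \<le> ?f b vs * (real n - real c) / real n"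
      by (intro divide_right_mono) auto
    also have "\<dots> = (1 - real c / real n) * ?f b vs"
      using assms(1) by (simp add: field_simps)
    finally show "(\<Sum>v\<in>{1..n}. of_bool (P (take N (vs @ [v])) \<and>
        (\<forall>i\<in>{a..<Suc (a + b)}. (vs @ [v]) ! i \<notin> A (take N (vs @ [v]))))) / real n
      \<le> (1 - real c / real n) * ?f b vs" by simp
  qed
  also have "\<dots> \<le> (1 - real c / real n) * (1 - real c / real n) ^ b"
    unfolding seq_avg_cmult using Suc assms(1,2) by (intro mult_left_mono) auto
  finally show ?case by simp
qed

lemma card_small_subsets_le: "card {T. T \<subseteq> {1..n} \<and> card T < k} \<le> (n + 1) ^ k"
proof -
  let ?X = "{xs. set xs \<subseteq> {0..n} \<and> length xs = k}"
  have "{T. T \<subseteq> {1..n} \<and> card T < k} \<subseteq> (\<lambda>xs. set xs \<inter> {1..n}) ` ?X"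
  proof clarify
    fix T assume T: "T \<subseteq> {1..n}" "card T < k"
    have "finite T" using T(1) finite_subset by blast
    then show "T \<in> (\<lambda>xs. set xs \<inter> {1..n}) ` ?X"
      \<comment> \<open>Sets are encoded as words of length \<open>k\<close>; the padding letter 0
        is removed by intersecting with \<open>{1..n}\<close>.\<close>
      using T by (intro image_eqI[of _ _ "sorted_list_of_set T @ replicate (k - card T) 0"]) auto
  qed
  then have "card {T. T \<subseteq> {1..n} \<and> card T < k} \<le> card ((\<lambda>xs. set xs \<inter> {1..n}) ` ?X)"
    by (intro card_mono finite_imageI finite_lists_length_eq) auto
  also have "\<dots> \<le> card ?X" by (intro card_image_le finite_lists_length_eq) auto
  also have "\<dots> = (n + 1) ^ k" by (subst card_lists_length_eq) auto
  finally show ?thesis .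
qed

section \<open>The combined strategy and its analysis\<close>

lemma det_history_predictable:
  "det_history (\<lambda>hist v. U (map snd hist)) vs = map (\<lambda>i. (U (take i vs), vs ! i)) [0..<length vs]"
proof (induction vs rule: rev_induct)
  case (snoc v vs)
  show ?case
    unfolding det_history_snoc map_snd_det_history by (auto simp: snoc.IH nth_append)
qed simp

lemma pick_graph_edge:
  assumes "(x, y) \<in> pick_graph n k wish vs"
  shows "\<exists>i<length vs. Upair x y = Upair (pick_move n k wish (take i vs)) (vs ! i)"
  using assms
proof (induction vs rule: rev_induct)
  case Nil
  then show ?case by (simp add: pick_graph_def)
next
  case (snoc v vs)
  have "(x, y) \<in> pick_graph n k wish vs \<or> Upair x y = Upair (pick_move n k wish vs) v"
    using snoc.prems by (auto simp: pick_graph_def pick_move_def low_step_def split: if_splits)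
  then show ?case
  proof
    assume "(x, y) \<in> pick_graph n k wish vs"
    from snoc.IH[OF this] obtain i where
      "i < length vs" "Upair x y = Upair (pick_move n k wish (take i vs)) (vs ! i)" by auto
    then show ?thesis by (intro exI[of _ i]) (auto simp: nth_append)
  qed (auto intro!: exI[of _ "length vs"])
qed

text \<open>From round \<open>N\<close> on, the hubs \<open>1, \<dots>, k\<close> are chosen for \<open>b\<close> rounds each. The reduction modulo
  \<open>k\<close> only keeps later, unused moves inside \<open>{1..n}\<close>.\<close>

definition hub_move :: "nat \<Rightarrow> nat \<Rightarrow> (nat list \<Rightarrow> nat) \<Rightarrow> nat \<Rightarrow> nat \<Rightarrow> nat list \<Rightarrow> nat" where
  "hub_move n k wish N b vs =
     (if length vs < N then pick_move n k wish vs else (length vs - N) div b mod k + 1)"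

text \<open>The component depends on the first \<open>N\<close> vertices only, while block
  \<open>j\<close> consists of \<open>b\<close> later rounds; rounds after the block are averaged
  out.\<close>

lemma seq_avg_hub_miss_le:
  assumes "n > 0" "c \<le> n" "j < k"
  shows "seq_avg n (N + k * b) (\<lambda>vs. of_bool (x \<in> {1..n} - T \<and>
           c \<le> card (component ({1..n} - T) (G (take N vs)) x) \<and>
           (\<forall>i\<in>{N + j * b..<N + j * b + b}. vs ! i \<notin> component ({1..n} - T) (G (take N vs)) x)))
         \<le> (1 - real c / real n) ^ b"
proof -
  define P where "P ys \<longleftrightarrow> x \<in> {1..n} - T \<and> c \<le> card (component ({1..n} - T) (G ys) x)" for ys
  define A where "A ys = component ({1..n} - T) (G ys) x" for ys
  define a where "a = N + j * b"
  let ?f = "\<lambda>vs. of_bool (P (take N vs) \<and> (\<forall>i\<in>{a..<a + b}. vs ! i \<notin> A (take N vs))) :: real"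
  have "j * b + b \<le> k * b" using assms(3) by (metis Suc_leI add.commute mult_Suc mult_le_mono1)
  then obtain e where e: "N + k * b = (a + b) + e"
    unfolding a_def by (metis add.assoc le_Suc_ex)
  have "seq_avg n ((a + b) + e) ?f = seq_avg n ((a + b) + e) (\<lambda>vs. ?f (take (a + b) vs))"
    by (rule seq_avg_cong) (auto simp: a_def min_def)
  also have "\<dots> = seq_avg n (a + b) ?f" by (rule seq_avg_take) (use assms in auto)
  also have "\<dots> \<le> (1 - real c / real n) ^ b"
  proof (rule seq_avg_avoid_le[OF assms(1,2)])
    show "A ys \<subseteq> {1..n} \<and> c \<le> card (A ys)" if "P ys" for ys
      using that component_subset[of x "{1..n} - T" "G ys"] by (auto simp: P_def A_def)
  qed (simp add: a_def)
  finally show ?thesis unfolding e by (simp add: P_def A_def a_def conj_assoc)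
qed

text \<open>The deterministic core: a vertex sequence that avoids all failure events makes the
  strategy succeed.\<close>

lemma hub_strategy_connected:
  assumes k: "3 \<le> k" "k < n" and d: "\<And>hist v. d hist v \<in> {1..n}" and b: "b > 0"
    and vs: "set vs \<subseteq> {1..n}" "length vs = N + k * b" and N: "N = M + 1 + r"
  defines "wish \<equiv> delayed_reply d"
  defines "G \<equiv> pick_graph n k wish (take N vs)"
  assumes min: "min_neighbours k {1..n} (edges_of (det_history d (take M vs)))"
    and bads: "\<not> r \<le> 2 * low_process.bads k (pick_move n k wish) (pick_graph n k wish) (take N vs)"
    and sparse: "\<not> (\<exists>W\<subseteq>{1..n}. W \<noteq> {} \<and> card W \<le> L \<and>
           card W + card W div (4 * k) + 1 \<le> card (G \<inter> W \<times> W) div 2)"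
    and hubs: "\<And>T x j. T \<subseteq> {1..n} \<Longrightarrow> card T < k \<Longrightarrow> x \<in> {1..n} - T \<Longrightarrow> j < k \<Longrightarrow>
      L + 1 - k \<le> card (component ({1..n} - T) G x) \<Longrightarrow>
      \<exists>i\<in>{N + j * b..<N + j * b + b}. vs ! i \<in> component ({1..n} - T) G x"
  shows "vertex_connected k {1..n}
    (edges_of (det_history (\<lambda>hist v. hub_move n k wish N b (map snd hist)) vs))"
proof -
  let ?U = "hub_move n k wish N b"
  let ?M = "edges_of (det_history (\<lambda>hist v. ?U (map snd hist)) vs)"
  interpret low_process n k "pick_move n k wish" "pick_graph n k wish"
    using low_process_pick[OF k(2)] .
  have wish: "wish xs \<in> {1..n}" for xs
    unfolding wish_def by (rule delayed_reply_in) (use d k in auto)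
  have vsN: "set (take N vs) \<subseteq> {1..n}" using vs(1) set_take_subset by fastforce
  have edge: "Upair (?U (take i vs)) (vs ! i) \<in># ?M" if "i < length vs" for i
    using that by (auto simp: det_history_predictable edges_of_def)
  show ?thesis
  proof (rule vertex_connected_by_hubs[where E = G and H = "{1..k}" and L = L])
    show "sgraph {1..n} G" unfolding G_def by (rule sgraph_G[OF vsN])
    show "k \<le> card (G `` {x})" if "x \<in> {1..n}" for x
      unfolding G_def
    \<comment> \<open>The reply to the vertex of round \<open>M\<close> is wished for one round
      later, so the demands are complete only after \<open>M + 1\<close> rounds.\<close>
    proof (rule pick_graph_min_degree[where L = "M + 1" and r = r])
      show "length (take N vs) = M + 1 + r" using vs N by simp
      have "take (M + 1) (take N vs) = take M vs @ [vs ! M]"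
        using vs N take_Suc_conv_app_nth[of M vs] by (simp add: min_absorb1)
      then show "\<forall>x\<in>{1..n}. k \<le> demand wish (take (M + 1) (take N vs)) x"
        unfolding wish_def using demand_of_min_neighbours[OF min] by simp
    qed (use k wish vsN bads that in auto)
    show "Upair x y \<in># ?M" if xy: "(x, y) \<in> G" for x y
    proof -
      obtain i where i: "i < length (take N vs)"
        "Upair x y = Upair (pick_move n k wish (take i (take N vs))) (take N vs ! i)"
        using pick_graph_edge[OF xy[unfolded G_def]] by auto
      then have lt: "i < N" "i < length vs" by auto
      then have "?U (take i vs) = pick_move n k wish (take i (take N vs))"
        by (simp add: hub_move_def min_absorb1)
      then show ?thesis using edge[OF lt(2)] lt(1) unfolding i(2) by simp
    qed
    show "\<exists>v\<in>component ({1..n} - T) G x. Upair j v \<in># ?M"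
      if T: "T \<subseteq> {1..n}" "card T < k" "x \<in> {1..n} - T" "j \<in> {1..k}"
        "L < card (component ({1..n} - T) G x) + k" for T x j
    proof -
      have "j - 1 < k" "L + 1 - k \<le> card (component ({1..n} - T) G x)" using T(4,5) by auto
      from hubs[OF T(1-3) this] obtain i where i: "i \<in> {N + (j - 1) * b..<N + (j - 1) * b + b}"
        "vs ! i \<in> component ({1..n} - T) G x"
        by blast
      have "(j - 1) * b + b \<le> k * b"
        using T(4) by (metis atLeastAtMost_iff le_add_diff_inverse2 mult.commute mult_le_mono2
            mult_Suc_right Suc_eq_plus1 add.commute)
      then have len: "i < length vs" using i(1) vs(2) by auto
      \<comment> \<open>Blocks are numbered from 0, hubs from 1.\<close>
      have "(i - N) div b = j - 1"
        using i(1) b by (intro div_nat_eqI) (auto simp: mult.commute)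
      then have "?U (take i vs) = j"
        using i(1) T(4) len by (auto simp: hub_move_def)
      then show ?thesis using edge[OF len] i(2) by auto
    qed
    show "card (G \<inter> W \<times> W) div 2 < card W + card W div (4 * k) + 1"
      if "W \<subseteq> {1..n}" "W \<noteq> {}" "card W \<le> L" for W
      using sparse that unfolding not_le[symmetric] by blast
  qed (use k in auto)
qed

text \<open>The subtracted terms bound three failures: too many wasted rounds, a dense small set,
  and a hub missing a large component. The rounds are \<open>M\<close> for the simulation, one for
  the delay, \<open>r\<close> for repair and \<open>k * b\<close> for the hubs.\<close>

lemma connecting_strategy:
  fixes n k L M r b :: nat
  defines "\<rho> \<equiv> 12 * 2 ^ k * real n powr (- 1 / (8 * real k))"
  defines "N \<equiv> M + 1 + r"
  assumes k: "3 \<le> k" "2 * k \<le> n" and L: "L * L \<le> n" and \<rho>: "\<rho> \<le> 1 / 2"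
    and r: "r > 0" and b: "b > 0" and \<sigma>: "builder_strategy n \<sigma>"
  shows "\<exists>\<sigma>'. builder_strategy n \<sigma>' \<and>
    measure_pmf.prob (semi_random n \<sigma> M) {hist. min_neighbours k {1..n} (edges_of hist)}
      - 2 * real N * real k / (real n * real r) - 2 * \<rho>
      - real ((n + 1) ^ k * n * k) * (1 - real (L + 1 - k) / real n) ^ b
    \<le> measure_pmf.prob (semi_random n \<sigma>' (N + k * b))
        {hist. vertex_connected k {1..n} (edges_of hist)}"
proof -
  have n: "n > 0" "k < n" using k by auto
  obtain d where d: "\<And>hist v. d hist v \<in> {1..n}"
    "measure_pmf.prob (semi_random n \<sigma> M) {hist. min_neighbours k {1..n} (edges_of hist)} \<le>
       seq_avg n M (\<lambda>vs. of_bool (min_neighbours k {1..n} (edges_of (det_history d vs))))"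
    using derandomise[OF n(1) \<sigma>] by blast
  define wish where "wish = delayed_reply d"
  interpret low_process n k "pick_move n k wish" "pick_graph n k wish"
    using low_process_pick[OF n(2)] .
  let ?G = "pick_graph n k wish" and ?V = "{1..n}"
  let ?U = "hub_move n k wish N b"
  \<comment> \<open>The new strategy ignores the current vertex \<open>v\<close>;
    \<open>map snd hist\<close> recovers the vertices drawn before.\<close>
  let ?d' = "\<lambda>hist v. ?U (map snd hist)"
  define Tot where "Tot = N + k * b"
  \<comment> \<open>The size that \<open>large_component\<close> guarantees for a component.\<close>
  define c where "c = L + 1 - k"
  define I where "I = {T. T \<subseteq> ?V \<and> card T < k} \<times> ?V \<times> {..<k}"
  have finI: "finite I" by (simp add: I_def)
  define A where "A vs \<longleftrightarrow> min_neighbours k ?V (edges_of (det_history d vs))" for vs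
  define B where "B vs \<longleftrightarrow> r \<le> 2 * bads vs" for vs
  define C where "C vs \<longleftrightarrow> (\<exists>W\<subseteq>?V. W \<noteq> {} \<and> card W \<le> L \<and>
           card W + card W div (4 * k) + 1 \<le> card (?G vs \<inter> W \<times> W) div 2)" for vs
  define D where "D = (\<lambda>(T, x, j) vs. x \<in> ?V - T \<and> c \<le> card (component (?V - T) (?G (take N vs)) x) \<and>
       (\<forall>i\<in>{N + j * b..<N + j * b + b}. vs ! i \<notin> component (?V - T) (?G (take N vs)) x))"
  define Q where "Q vs \<longleftrightarrow> vertex_connected k ?V (edges_of (det_history ?d' vs))" for vs
  have U: "?U vs \<in> ?V" for vs
    using move_in[of vs] n mod_less_divisor[of k "(length vs - N) div b"] k
    by (auto simp: hub_move_def simp del: mod_less_divisor)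
  have "L \<le> n"
    using L by (metis le_square order.trans)
  then have cn: "c \<le> n" using k by (simp add: c_def)
  \<comment> \<open>The union bound for a single sequence: if the simulated strategy succeeds and
    the new one fails, then \<open>B\<close>, \<open>C\<close> or some \<open>D\<close>
    occurs.\<close>
  have pointwise: "of_bool (A (take M vs)) \<le> of_bool (Q vs) + of_bool (B (take N vs))
      + of_bool (C (take N vs)) + (\<Sum>i\<in>I. of_bool (D i vs) :: real)"
    if vs: "length vs = Tot" "set vs \<subseteq> ?V" for vs
  proof (cases "A (take M vs) \<and> \<not> B (take N vs) \<and> \<not> C (take N vs) \<and> (\<forall>i\<in>I. \<not> D i vs)")
    case True
    have "Q vs"
      unfolding Q_def wish_def
    proof (rule hub_strategy_connected[OF k(1) n(2) d(1) b vs(2)])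
      show "length vs = N + k * b" using vs by (simp add: Tot_def)
      show "N = M + 1 + r" by (simp add: N_def)
      show "\<exists>i\<in>{N + j * b..<N + j * b + b}. vs ! i \<in>
          component ({1..n} - T) (pick_graph n k (delayed_reply d) (take N vs)) x"
        if "T \<subseteq> ?V" "card T < k" "x \<in> ?V - T" "j < k"
          "L + 1 - k \<le> card (component ({1..n} - T) (pick_graph n k (delayed_reply d) (take N vs)) x)"
        for T x j
      proof -
        have "(T, x, j) \<in> I" using that by (auto simp: I_def)
        then have "\<not> D (T, x, j) vs" using True by blast
        then show ?thesis using that unfolding D_def wish_def c_def by auto
      qed
    qed (use True in \<open>auto simp: A_def B_def C_def wish_def\<close>)
    then show ?thesis by (auto intro!: add_nonneg_nonneg sum_nonneg)
  next
    case False
    have S: "0 \<le> (\<Sum>i\<in>I. of_bool (D i vs) :: real)" by (auto intro: sum_nonneg)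
    show ?thesis
    proof (cases "\<exists>i\<in>I. D i vs")
      case True
      then obtain i where i: "i \<in> I" "D i vs" by auto
      have "of_bool (D i vs) \<le> (\<Sum>i\<in>I. of_bool (D i vs) :: real)"
        using finI i(1) by (intro member_le_sum) auto
      then show ?thesis using i(2) by (auto simp: of_bool_def)
    next
      case False
      with \<open>\<not> (A _ \<and> _)\<close> S show ?thesis by (auto simp: of_bool_def)
    qed
  qed
  have TotM: "Tot = M + (1 + r + k * b)" and TotN: "Tot = N + k * b"
    by (auto simp: Tot_def N_def)
  have "seq_avg n M (\<lambda>vs. of_bool (A vs)) = seq_avg n Tot (\<lambda>vs. of_bool (A (take M vs)))"
    unfolding TotM by (rule seq_avg_take[OF n(1), symmetric])
  also have "\<dots> \<le> seq_avg n Tot (\<lambda>vs. of_bool (Q vs) + of_bool (B (take N vs))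
      + of_bool (C (take N vs)) + (\<Sum>i\<in>I. of_bool (D i vs) :: real))"
    by (rule seq_avg_mono) (use pointwise in blast)
  also have "\<dots> = seq_avg n Tot (\<lambda>vs. of_bool (Q vs)) + seq_avg n N (\<lambda>vs. of_bool (B vs))
      + seq_avg n N (\<lambda>vs. of_bool (C vs)) + (\<Sum>i\<in>I. seq_avg n Tot (\<lambda>vs. of_bool (D i vs)))"
    unfolding seq_avg_add seq_avg_sum
    by (simp add: TotN seq_avg_take[OF n(1), of N _ "\<lambda>vs. of_bool (B vs)"]
        seq_avg_take[OF n(1), of N _ "\<lambda>vs. of_bool (C vs)"])
  also have "\<dots> \<le> seq_avg n Tot (\<lambda>vs. of_bool (Q vs)) + 2 * real N * real k / (real n * real r)
      + 2 * \<rho> + real ((n + 1) ^ k * n * k) * (1 - real c / real n) ^ b"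
  proof (intro add_mono order_refl)
    show "seq_avg n N (\<lambda>vs. of_bool (B vs)) \<le> 2 * real N * real k / (real n * real r)"
      unfolding B_def by (rule seq_avg_many_bads_le[OF r])
    show "seq_avg n N (\<lambda>vs. of_bool (C vs)) \<le> 2 * \<rho>"
      unfolding C_def \<rho>_def by (rule seq_avg_some_dense_le[OF k L \<rho>[unfolded \<rho>_def]])
    have "(\<Sum>i\<in>I. seq_avg n Tot (\<lambda>vs. of_bool (D i vs))) \<le> (\<Sum>i\<in>I. (1 - real c / real n) ^ b)"
    proof (rule sum_mono)
      fix i assume i: "i \<in> I"
      obtain T x j where "i = (T, x, j)" "j < k" using i by (auto simp: I_def)
      then show "seq_avg n Tot (\<lambda>vs. of_bool (D i vs)) \<le> (1 - real c / real n) ^ b"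
        unfolding TotN D_def using seq_avg_hub_miss_le[OF n(1) cn, of j k N b x T ?G] by simp
    qed
    also have "\<dots> = real (card I) * (1 - real c / real n) ^ b" by simp
    also have "\<dots> \<le> real ((n + 1) ^ k * n * k) * (1 - real c / real n) ^ b"
    proof (rule mult_right_mono)
      show "real (card I) \<le> real ((n + 1) ^ k * n * k)"
        unfolding I_def card_cartesian_product of_nat_le_iff
        using card_small_subsets_le[of n k] by (simp add: mult_le_mono)
    qed (use cn n in auto)
    finally show "(\<Sum>i\<in>I. seq_avg n Tot (\<lambda>vs. of_bool (D i vs))) \<le>
      real ((n + 1) ^ k * n * k) * (1 - real c / real n) ^ b" .
  qed
  finally have main: "seq_avg n M (\<lambda>vs. of_bool (A vs)) \<le> \<dots>" .
  have "seq_avg n Tot (\<lambda>vs. of_bool (Q vs)) =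
    measure_pmf.prob (semi_random n (\<lambda>hist v. return_pmf (?d' hist v)) Tot)
      {hist. vertex_connected k ?V (edges_of hist)}"
    unfolding Q_def by (rule prob_det_strategy[OF n(1) U, symmetric])
  moreover have "builder_strategy n (\<lambda>hist v. return_pmf (?d' hist v))"
    using U by (auto simp: builder_strategy_def)
  ultimately show ?thesis
    using main d(2) unfolding A_def[symmetric] Tot_def c_def by (intro exI conjI) auto
qed

section \<open>Asymptotics\<close>

text \<open>A finite bound excludes the infimum of the empty set, and the infimum of a nonempty set
  of \<open>enat\<close> is attained.\<close>

lemma tau_leE:
  assumes "ereal_of_enat (tau p P n) \<le> ereal x"
  obtains m \<sigma> where "real m \<le> x" "builder_strategy n \<sigma>"
    "p \<le> measure_pmf.prob (semi_random n \<sigma> m) {hist. P {1..n} (edges_of hist)}"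
proof -
  define A where "A = {enat m | m. \<exists>\<sigma>. builder_strategy n \<sigma> \<and>
     measure_pmf.prob (semi_random n \<sigma> m) {hist. P {1..n} (edges_of hist)} \<ge> p}"
  have tau: "tau p P n = Inf A" by (simp add: tau_def A_def)
  have "A \<noteq> {}" using assms unfolding tau by (auto simp: Inf_enat_def)
  then have "Inf A \<in> A" by (auto simp: Inf_enat_def intro: LeastI)
  then obtain m \<sigma> where "Inf A = enat m" "builder_strategy n \<sigma>"
    "p \<le> measure_pmf.prob (semi_random n \<sigma> m) {hist. P {1..n} (edges_of hist)}"
    unfolding A_def by auto
  with assms that show ?thesis unfolding tau by simp
qed

lemma tau_le:
  assumes "builder_strategy n \<sigma>"
    "p \<le> measure_pmf.prob (semi_random n \<sigma> m) {hist. P {1..n} (edges_of hist)}"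
  shows "tau p P n \<le> enat m"
  unfolding tau_def using assms by (intro Inf_lower) auto

lemma tau_antimono:
  assumes "\<And>M. P {1..n} M \<Longrightarrow> Q {1..n} M"
  shows "tau p Q n \<le> tau p P n"
  unfolding tau_def
proof (rule Inf_superset_mono, clarify)
  fix m \<sigma> assume \<sigma>: "builder_strategy n \<sigma>"
    "p \<le> measure_pmf.prob (semi_random n \<sigma> m) {hist. P {1..n} (edges_of hist)}"
  have "measure_pmf.prob (semi_random n \<sigma> m) {hist. P {1..n} (edges_of hist)} \<le>
      measure_pmf.prob (semi_random n \<sigma> m) {hist. Q {1..n} (edges_of hist)}"
    using assms by (intro measure_pmf.finite_measure_mono) auto
  then show "\<exists>m'. enat m = enat m' \<and> (\<exists>\<sigma>. builder_strategy n \<sigma> \<and>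
      p \<le> measure_pmf.prob (semi_random n \<sigma> m') {hist. Q {1..n} (edges_of hist)})"
    using \<sigma> by (intro exI[of _ m]) (auto intro: order.trans)
qed

section \<open>Vanishing error terms\<close>

lemma tendsto_dense_error:
  assumes "(k::nat) > 0"
  shows "(\<lambda>n. 12 * 2 ^ k * real n powr (- 1 / (8 * real k))) \<longlonglongrightarrow> 0"
proof -
  have "(\<lambda>n. real n powr (- 1 / (8 * real k))) \<longlonglongrightarrow> 0"
    using assms by real_asymp
  from tendsto_mult_left[OF this, of "12 * 2 ^ k"] show ?thesis by simp
qed

lemma tendsto_hub_error:
  assumes "(k::nat) > 0" "(e::real) > 0"
  shows "(\<lambda>n. real ((n + 1) ^ k * n * k) * exp (- (e * (sqrt (real n) - real k)))) \<longlonglongrightarrow> 0"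
proof -
  have "(\<lambda>n. (real n + 1) powr real k * real n * real k * exp (- (e * (sqrt (real n) - real k)))) \<longlonglongrightarrow> 0"
    using assms by real_asymp
  then show ?thesis by (simp add: powr_realpow add.commute)
qed

text \<open>Uses \<open>1 - x \<le> exp (- x)\<close> with component size at least
  \<open>sqrt n - k\<close> and at least \<open>e * n\<close> rounds per hub; \<open>e\<close> is a
  free parameter here.\<close>

lemma hub_error_le:
  assumes n: "n > 0" and L: "L = nat \<lfloor>sqrt (real n)\<rfloor>" and k: "real k \<le> sqrt (real n)"
    and b: "e * real n \<le> real b" and k3: "k \<ge> 1"
  shows "(1 - real (L + 1 - k) / real n) ^ b \<le> exp (- (e * (sqrt (real n) - real k)))"
proof -
  let ?c = "real (L + 1 - k)"
  have "sqrt (real n) < real L + 1" unfolding L by linarith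
  then have c: "sqrt (real n) - real k \<le> ?c" by linarith
  have "real L \<le> sqrt (real n)" unfolding L by simp
  also have "\<dots> \<le> real n"
    using n by (intro real_le_lsqrt) (auto simp: power2_eq_square)
  finally have "?c \<le> real n" using k3 by linarith
  then have "(1 - ?c / real n) ^ b \<le> exp (- (?c / real n)) ^ b"
    using n exp_ge_add_one_self[of "- (?c / real n)"] by (intro power_mono) auto
  also have "\<dots> = exp (- (real b * ?c / real n))" by (simp flip: exp_of_nat_mult)
  also have "\<dots> \<le> exp (- (e * (sqrt (real n) - real k)))"
  proof -
    have "e * (sqrt (real n) - real k) \<le> (real b / real n) * (sqrt (real n) - real k)"
      using b n k by (intro mult_right_mono) (auto simp: field_simps)
    also have "\<dots> \<le> (real b / real n) * ?c" using c by (intro mult_left_mono) auto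
    finally show ?thesis by simp
  qed
  finally show ?thesis .
qed

theorem theorem1p14:
  fixes k :: nat and h :: real
  assumes "k \<ge> 3"
    and "h > 0"
    and "whp_tau_asymp (min_neighbours k) h"
  shows "whp_tau_asymp (vertex_connected k) h"
  unfolding whp_tau_asymp_def
proof (intro allI impI conjI)
  fix \<delta> :: real assume \<delta>: "\<delta> > 0"
  show "\<exists>p. (\<forall>n. 0 \<le> p n \<and> p n \<le> 1) \<and> p \<longlonglongrightarrow> 0 \<and> (\<forall>\<^sub>F n in sequentially.
      ereal ((h - \<delta>) * real n) \<le> ereal_of_enat (tau (p n) (vertex_connected k) n))"
  proof -
    obtain p where p: "\<forall>n. 0 \<le> p n \<and> p n \<le> 1" "p \<longlonglongrightarrow> 0" "\<forall>\<^sub>F n in sequentially.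
        ereal ((h - \<delta>) * real n) \<le> ereal_of_enat (tau (p n) (min_neighbours k) n)"
      using assms(3) \<delta> unfolding whp_tau_asymp_def by blast
    have "ereal_of_enat (tau q (min_neighbours k) n) \<le> ereal_of_enat (tau q (vertex_connected k) n)"
      for q n
      unfolding ereal_of_enat_le_iff
      by (rule tau_antimono) (rule vertex_connected_imp_min_neighbours, simp)
    with p show ?thesis
      by (intro exI[of _ p]) (auto elim!: eventually_mono intro: order.trans)
  qed
  \<comment> \<open>The slack \<open>\<delta> * n\<close> is split into a quarter for the simulated
    strategy, a sixteenth each for repair and for hubs, and at most a half for additive
    constants.\<close>
  have "\<delta> / 4 > 0" using \<delta> by simp
  then obtain p where p: "\<forall>n. 0 \<le> p n \<and> p n \<le> 1" "p \<longlonglongrightarrow> 1" "\<forall>\<^sub>F n in sequentially.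
      ereal_of_enat (tau (p n) (min_neighbours k) n) \<le> ereal ((h + \<delta> / 4) * real n)"
    using assms(3) unfolding whp_tau_asymp_def by blast
  define \<rho> where "\<rho> n = 12 * 2 ^ k * real n powr (- 1 / (8 * real k))" for n
  define e where "e = \<delta> / (16 * real k)"
  define hub where "hub n = real ((n + 1) ^ k * n * k) * exp (- (e * (sqrt (real n) - real k)))"
    for n
  \<comment> \<open>Bounds the wasted-rounds term, using at most \<open>(h + \<delta>) * n\<close>
    rounds and \<open>r \<ge> \<delta> / 16 * n\<close>.\<close>
  define deg where "deg n = 32 * (h + \<delta>) * real k / (\<delta> * real n)" for n
  \<comment> \<open>For small \<open>n\<close> the difference may be negative; the maximum keeps
    \<open>q n\<close> a probability.\<close>
  define q where "q n = max 0 (p n - deg n - 2 * \<rho> n - hub n)" for n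
  have e: "e > 0" using \<delta> assms(1) by (simp add: e_def)
  have \<rho>0: "\<rho> \<longlonglongrightarrow> 0" unfolding \<rho>_def using assms(1) by (intro tendsto_dense_error) simp
  have hub0: "hub \<longlonglongrightarrow> 0" unfolding hub_def using assms(1) e by (intro tendsto_hub_error) auto
  have deg0: "deg \<longlonglongrightarrow> 0" unfolding deg_def using \<delta> by real_asymp
  have "q \<longlonglongrightarrow> max 0 (1 - 0 - 2 * 0 - 0)"
    unfolding q_def by (intro tendsto_intros p(2) \<rho>0 hub0 deg0)
  then have "q \<longlonglongrightarrow> 1" by simp
  moreover have "0 \<le> q n \<and> q n \<le> 1" for n
  proof -
    have "0 \<le> deg n" "0 \<le> \<rho> n" "0 \<le> hub n"
      using assms(2) \<delta> by (auto simp: deg_def \<rho>_def hub_def)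
    then show ?thesis using p(1)[rule_format, of n] by (auto simp: q_def)
  qed
  moreover have "\<forall>\<^sub>F n in sequentially.
      ereal_of_enat (tau (q n) (vertex_connected k) n) \<le> ereal ((h + \<delta>) * real n)"
  proof -
    have "\<forall>\<^sub>F n in sequentially. \<rho> n < 1 / 2"
      using \<rho>0 by (rule order_tendstoD) simp
    moreover have "\<forall>\<^sub>F n in sequentially. 2 * k \<le> n" by (rule eventually_ge_at_top)
    moreover have "\<forall>\<^sub>F n in sequentially. real k \<le> sqrt (real n)" by real_asymp
    \<comment> \<open>The constant \<open>k + 2\<close> collects the delay round and the rounding up
      in \<open>r\<close> and in the \<open>k\<close> hub blocks.\<close>
    moreover have "\<forall>\<^sub>F n in sequentially. real k + 2 \<le> \<delta> / 2 * real n" using \<delta> by real_asymp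
    ultimately show ?thesis using p(3)
    proof eventually_elim
      case (elim n)
      obtain M \<sigma> where M: "real M \<le> (h + \<delta> / 4) * real n" and \<sigma>: "builder_strategy n \<sigma>"
        "p n \<le> measure_pmf.prob (semi_random n \<sigma> M) {hist. min_neighbours k {1..n} (edges_of hist)}"
        using tau_leE[OF elim(5)] by blast
      define L where "L = nat \<lfloor>sqrt (real n)\<rfloor>"
      define r where "r = nat \<lceil>\<delta> / 16 * real n\<rceil>"
      define b where "b = nat \<lceil>e * real n\<rceil>"
      have n: "n > 0" using elim(2) assms(1) by simp
      have r: "\<delta> / 16 * real n \<le> real r" "real r \<le> \<delta> / 16 * real n + 1"
        using \<delta> by (auto simp: r_def)
      have b: "e * real n \<le> real b" "real b \<le> e * real n + 1"
        using e by (auto simp: b_def)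
      have "0 < \<delta> / 16 * real n" "0 < e * real n" using \<delta> e n by auto
      then have pos: "r > 0" "b > 0" using r b by linarith+
      have LL: "L * L \<le> n"
      proof -
        have "real L \<le> sqrt (real n)" by (simp add: L_def)
        then have "real L * real L \<le> sqrt (real n) * sqrt (real n)" by (intro mult_mono) auto
        then show ?thesis by (simp flip: of_nat_mult)
      qed
      let ?N = "M + 1 + r"
      have kb: "real k * real b \<le> \<delta> / 16 * real n + real k"
      proof -
        have "real k * real b \<le> real k * (e * real n + 1)" using b by (intro mult_left_mono) auto
        also have "\<dots> = \<delta> / 16 * real n + real k" using assms(1) by (simp add: e_def field_simps)
        finally show ?thesis .
      qed
      have total: "real (?N + k * b) \<le> (h + \<delta>) * real n"
        using M r(2) kb elim(4) \<delta> by (simp add: algebra_simps)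
      then have N: "real ?N \<le> (h + \<delta>) * real n"
        by (smt (verit) of_nat_add of_nat_0_le_iff)
      obtain \<sigma>' where \<sigma>': "builder_strategy n \<sigma>'"
        "measure_pmf.prob (semi_random n \<sigma> M) {hist. min_neighbours k {1..n} (edges_of hist)}
          - 2 * real ?N * real k / (real n * real r) - 2 * \<rho> n
          - real ((n + 1) ^ k * n * k) * (1 - real (L + 1 - k) / real n) ^ b
        \<le> measure_pmf.prob (semi_random n \<sigma>' (?N + k * b))
            {hist. vertex_connected k {1..n} (edges_of hist)}"
        using connecting_strategy[OF assms(1) elim(2) LL _ pos \<sigma>(1)] elim(1)
        unfolding \<rho>_def by force
      have "2 * real ?N * real k / (real n * real r) \<le>
          2 * ((h + \<delta>) * real n) * real k / (real n * (\<delta> / 16 * real n))"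
        using N r(1) n \<delta> pos assms(2) by (intro frac_le mult_mono mult_left_mono mult_pos_pos) auto
      also have "\<dots> = deg n" using n \<delta> by (simp add: deg_def field_simps)
      finally have "2 * real ?N * real k / (real n * real r) \<le> deg n" .
      moreover have "real ((n + 1) ^ k * n * k) * (1 - real (L + 1 - k) / real n) ^ b \<le> hub n"
        unfolding hub_def
        using hub_error_le[OF n L_def elim(3) b(1)] assms(1) by (intro mult_left_mono) auto
      ultimately have "q n \<le> measure_pmf.prob (semi_random n \<sigma>' (?N + k * b))
            {hist. vertex_connected k {1..n} (edges_of hist)}"
        using \<sigma>(2) \<sigma>'(2) unfolding q_def by (intro max.boundedI measure_nonneg) linarith
      from tau_le[where P = "vertex_connected k" and p = "q n", OF \<sigma>'(1) this] have "ereal_of_enat (tau (q n) (vertex_connected k) n) \<le>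
          ereal_of_enat (enat (?N + k * b))"
        by (simp only: ereal_of_enat_le_iff)
      also have "\<dots> \<le> ereal ((h + \<delta>) * real n)" using total by simp
      finally show ?case .
    qed
  qed
  ultimately show "\<exists>p. (\<forall>n. 0 \<le> p n \<and> p n \<le> 1) \<and> p \<longlonglongrightarrow> 1 \<and> (\<forall>\<^sub>F n in sequentially.
      ereal_of_enat (tau (p n) (vertex_connected k) n) \<le> ereal ((h + \<delta>) * real n))"
    by blast
qed

end
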